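(* Let $\Gamma$ be a countable discrete group acting expansively by automorphisms on a compact metrizable abelian group $X$. Then $\Delta(X)=\Delta^1(X)$.
   Context: The action is expansive if, for a compatible metric $\rho$ on $X$, there is $c>0$ with $\sup_{s\in\Gamma}\rho(sx,sy)>c$ for all distinct $x,y\in X$. $\Delta(X)$ is the group of homoclinic points: those $x\in X$ with $sx\to e_X$ as $\Gamma\ni s\to\infty$. For $x\in X$ and $\varphi\in\widehat{X}$ (the Pontryagin dual) let $\Psi_{x,\varphi}(s)=\langle sx,\varphi\rangle-1$ for $s\in\Gamma$, with $\langle\cdot,\cdot\rangle:X\times\widehat{X}\to\mathbb{T}$ the canonical pairing. $\Delta^1(X)$ is the set of $x\in X$ such that $\sum_{s\in\Gamma}|\Psi_{x,\varphi}(s)|<+\infty$ for every $\varphi\in\widehat{X}$. *)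

theory Defs
  imports "HOL-Analysis.Analysis"
begin

(* The acting group is a type of class group_add: this class is written additively but is not
   commutative.  The acting group carries no topology; being discrete, it imposes no continuity
   condition in the group variable. *)

(* A left action by continuous group automorphisms.  Each map alpha s has the continuous inverse
   alpha (- s), so continuity makes it a homeomorphism. *)
definition acts_by_automorphisms ::
    "('g::group_add \<Rightarrow> 'x::topological_ab_group_add \<Rightarrow> 'x) \<Rightarrow> bool" where
  "acts_by_automorphisms \<alpha> \<longleftrightarrow>
     (\<forall>x. \<alpha> 0 x = x) \<and>
     (\<forall>s t x. \<alpha> (s + t) x = \<alpha> s (\<alpha> t x)) \<and>
     (\<forall>s x y. \<alpha> s (x + y) = \<alpha> s x + \<alpha> s y) \<and>
     (\<forall>s. continuous_on UNIV (\<alpha> s))"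

definition compatible_metric :: "('x::topological_space \<Rightarrow> 'x \<Rightarrow> real) \<Rightarrow> bool" where
  "compatible_metric \<rho> \<longleftrightarrow>
     Metric_space UNIV \<rho> \<and> Metric_space.mtopology UNIV \<rho> = euclidean"

(* On a compact space a compatible metric is bounded, so the real-valued supremum is the true
   one. *)
definition expansive :: "('g \<Rightarrow> 'x::topological_space \<Rightarrow> 'x) \<Rightarrow> bool" where
  "expansive \<alpha> \<longleftrightarrow>
     (\<exists>\<rho>. compatible_metric \<rho> \<and>
        (\<exists>c>0. \<forall>x y. x \<noteq> y \<longrightarrow> (SUP s. \<rho> (\<alpha> s x) (\<alpha> s y)) > c))"

(* The filter cofinite expresses that s leaves every finite subset of the acting group; for a
   finite group it is trivial and every point is homoclinic. *)
definition homoclinic_points ::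
    "('g \<Rightarrow> 'x::{topological_space, zero} \<Rightarrow> 'x) \<Rightarrow> 'x set" where
  "homoclinic_points \<alpha> = {x. ((\<lambda>s. \<alpha> s x) \<longlongrightarrow> 0) cofinite}"

(* The circle group is the unit circle in the complex plane, and the canonical pairing of x
   with a character phi is phi x. *)
definition pontryagin_dual :: "('x::topological_ab_group_add \<Rightarrow> complex) set" where
  "pontryagin_dual =
     {\<phi>. continuous_on UNIV \<phi> \<and> (\<forall>x. cmod (\<phi> x) = 1) \<and>
         (\<forall>x y. \<phi> (x + y) = \<phi> x * \<phi> y)}"

definition Psi :: "('g \<Rightarrow> 'x \<Rightarrow> 'x) \<Rightarrow> 'x \<Rightarrow> ('x \<Rightarrow> complex) \<Rightarrow> 'g \<Rightarrow> complex" where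
  "Psi \<alpha> x \<phi> s = \<phi> (\<alpha> s x) - 1"

definition one_homoclinic_points ::
    "('g \<Rightarrow> 'x::topological_ab_group_add \<Rightarrow> 'x) \<Rightarrow> 'x set" where
  "one_homoclinic_points \<alpha> =
     {x. \<forall>\<phi>\<in>pontryagin_dual. (\<lambda>s. cmod (Psi \<alpha> x \<phi> s)) summable_on UNIV}"

end

theory Submission
  imports Defs "HOL-Analysis.Finite_Function_Topology"
begin

text \<open>Both inclusions need enough characters. Convex combinations of translates of a continuous
  function on the compact abelian group come uniformly close to a constant, its mean. For
  \<open>f\<close> with mean square 1 let \<open>q\<close> be the convolution of the autocorrelation of \<open>f\<close> with a fixed
  kernel; these \<open>q\<close> are equicontinuous, and a limit \<open>q\<close> of maximal norm is an extreme point.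
  Splitting \<open>f\<close> into the halves \<open>(f + c T f) / 2\<close> and \<open>(f - c T f) / 2\<close> for a translation \<open>T\<close> and
  \<open>c = 1, \<i>\<close> shows that \<open>q\<close> is an eigenvector of every translation, hence proportional to a
  character. Characters therefore separate points and their level sets form a neighbourhood base
  at 0, so 1-homoclinic points are homoclinic.

  Conversely, expansiveness and compactness give finitely many characters \<open>\<phi>\<^sub>i\<close>, among them a
  given one, and a finite set \<open>F\<close> of group elements such that smallness of all angles
  \<open>Arg (\<phi>\<^sub>i (s x))\<close> with \<open>s \<in> F\<close> makes the angles \<open>Arg (\<phi>\<^sub>i x)\<close> smaller by a factor \<open>\<delta>\<close>. Near 0 the
  angles are additive, so this is a bound for linear functionals in the supremum norm, and
  Hahn-Banach turns it into \<open>Arg (\<phi>\<^sub>j x) = (\<Sum>i s. c\<^sub>i\<^sub>s Arg (\<phi>\<^sub>i (s x)))\<close> with \<open>(\<Sum>i s. \<bar>c\<^sub>i\<^sub>s\<bar>) \<le> \<delta>\<close>. Along the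
  orbit of a homoclinic point this holds outside a finite set; for small \<open>\<delta>\<close> the right-hand side
  is a contraction of \<open>\<ell>\<^sup>1\<close>, which forces the angles to be summable.\<close>


section \<open>Uniform continuity and finite nets on a compact group\<close>

text \<open>Tube-lemma argument: continuity of \<open>f (y + u)\<close> at \<open>(z, 0)\<close> in
  both variables gives a product neighbourhood. Finitely many sets \<open>A z\<close> cover the
  group, and the intersection of the matching \<open>B z\<close> serves every point.\<close>

lemma eventually_uniform_translate:
  fixes f :: "'x::topological_ab_group_add \<Rightarrow> 'b::metric_space"
  assumes cpt: "compact (UNIV :: 'x set)" and f: "continuous_on UNIV f" and "e > 0"
  shows "\<forall>\<^sub>F u in nhds 0. \<forall>z. dist (f (z + u)) (f z) < e"
proof -
  have "\<exists>A B. open A \<and> z \<in> A \<and> open B \<and> 0 \<in> B \<and> (\<forall>y\<in>A. \<forall>u\<in>B. dist (f (y + u)) (f y) < e)" for z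
  proof -
    define W where "W = {p. dist (f (fst p + snd p)) (f (fst p)) < e}"
    have "open W"
      unfolding W_def
      by (intro open_Collect_less continuous_intros continuous_on_compose2[OF f]) auto
    moreover have "(z, 0) \<in> W"
      using \<open>e > 0\<close> by (simp add: W_def)
    ultimately obtain A B where "open A" "open B" "(z, 0) \<in> A \<times> B" "A \<times> B \<subseteq> W"
      by (rule open_prod_elim)
    moreover from this have "dist (f (y + u)) (f y) < e" if "y \<in> A" "u \<in> B" for y u
      using that by (auto simp: W_def subset_iff)
    ultimately show ?thesis
      by blast
  qed
  then obtain A B where AB: "\<And>z. open (A z)" "\<And>z. z \<in> A z" "\<And>z. open (B z)" "\<And>z. 0 \<in> B z"
    "\<And>z y u. y \<in> A z \<Longrightarrow> u \<in> B z \<Longrightarrow> dist (f (y + u)) (f y) < e"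
    by metis
  obtain T where T: "finite T" "UNIV \<subseteq> (\<Union>z\<in>T. A z)"
  proof (rule compactE_image[OF cpt])
    show "UNIV \<subseteq> (\<Union>z\<in>UNIV. A z)" using AB(2) by auto
  qed (use AB(1) in auto)
  have "open (\<Inter>z\<in>T. B z)"
    using T AB by auto
  moreover have "0 \<in> (\<Inter>z\<in>T. B z)"
    using AB by auto
  ultimately have "\<forall>\<^sub>F u in nhds 0. u \<in> (\<Inter>z\<in>T. B z)"
    by (rule eventually_nhds_in_open)
  then show ?thesis
  proof eventually_elim
    case (elim u)
    show ?case
    proof
      fix z
      obtain y where "y \<in> T" "z \<in> A y" using T by blast
      then show "dist (f (z + u)) (f z) < e" using AB(5) elim by blast
    qed
  qed
qed

text \<open>Plays the part of a finite net in a group without a chosen metric. The net is a list so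
  that it can be fed to \<open>avg\<close>.\<close>

lemma finite_translate_cover:
  fixes U :: "'x::topological_ab_group_add set"
  assumes cpt: "compact (UNIV :: 'x set)" and "\<forall>\<^sub>F u in nhds 0. u \<in> U"
  obtains A where "A \<noteq> []" "\<And>x. \<exists>a\<in>set A. x - a \<in> U"
proof -
  obtain V where V: "open V" "0 \<in> V" "V \<subseteq> U"
    using assms(2) by (auto simp: eventually_nhds)
  have op: "open {x. x - a \<in> V}" for a
    using open_vimage[OF V(1), of "\<lambda>x. x - a"] unfolding vimage_def
    by (simp add: continuous_on_diff continuous_on_id continuous_on_const)
  have cov: "UNIV \<subseteq> (\<Union>a\<in>UNIV. {x. x - a \<in> V})"
  proof
    fix x show "x \<in> (\<Union>a\<in>UNIV. {x. x - a \<in> V})"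
      using V(2) by (intro UN_I[of x]) auto
  qed
  obtain T where T: "finite T" "UNIV \<subseteq> (\<Union>a\<in>T. {x. x - a \<in> V})"
    by (rule compactE_image[OF cpt op cov])
  obtain A where A: "set A = T"
    using T(1) finite_list by blast
  show thesis
  proof
    show "A \<noteq> []" using A T(2) by auto
    show "\<exists>a\<in>set A. x - a \<in> U" for x
      using A T(2) V(3) by blast
  qed
qed

section \<open>The invariant mean of a compact abelian group\<close>

text \<open>Lists allow repetitions, so a composition of two averages is again an average
  (\<open>avg_list_sums\<close>). The empty list gives 0, hence the later conditions
  \<open>L \<noteq> []\<close>.\<close>

definition avg :: "'a::ab_group_add list \<Rightarrow> ('a \<Rightarrow> 'b::real_normed_vector) \<Rightarrow> 'a \<Rightarrow> 'b" where
  "avg L f x = (\<Sum>i<length L. f (x + L ! i)) /\<^sub>R real (length L)"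

definition list_sums :: "'a::ab_group_add list \<Rightarrow> 'a list \<Rightarrow> 'a list" where
  "list_sums L L' = concat (map (\<lambda>a. map (\<lambda>b. a + b) L') L)"

lemma list_sums_ne: "L \<noteq> [] \<Longrightarrow> L' \<noteq> [] \<Longrightarrow> list_sums L L' \<noteq> []"
  by (cases L) (auto simp: list_sums_def)

lemma avg_sum_list: "avg L f x = (\<Sum>a\<leftarrow>L. f (x + a)) /\<^sub>R real (length L)"
  by (simp add: avg_def sum_list_sum_nth atLeast0LessThan)

lemma avg_list_sums: "avg (list_sums L L') f = avg L (avg L' f)"
proof
  fix x
  have len: "length (list_sums L L') = length L * length L'"
    by (induction L) (auto simp: list_sums_def)
  have "(\<Sum>a\<leftarrow>list_sums L L'. f (x + a)) = (\<Sum>a\<leftarrow>L. \<Sum>b\<leftarrow>L'. f (x + a + b))"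
    by (induction L) (auto simp: list_sums_def o_def add.assoc)
  moreover have "avg L (avg L' f) x = (\<Sum>a\<leftarrow>L. \<Sum>b\<leftarrow>L'. f (x + a + b)) /\<^sub>R (real (length L) * real (length L'))"
    by (simp only: avg_sum_list sum_list_sum_nth length_map) (simp add: scaleR_sum_right mult.commute)
  ultimately show "avg (list_sums L L') f x = avg L (avg L' f) x"
    by (simp add: avg_sum_list[of "list_sums L L'"] len)
qed

lemma avg_commute: "avg L (avg L' f) = avg L' (avg L f)"
proof
  fix x
  have "(\<Sum>i<length L. \<Sum>j<length L'. f (x + L ! i + L' ! j)) = (\<Sum>j<length L'. \<Sum>i<length L. f (x + L' ! j + L ! i))"
    by (subst sum.swap) (simp add: algebra_simps)
  then show "avg L (avg L' f) x = avg L' (avg L f) x"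
    by (simp only: avg_def scaleR_sum_right[symmetric] scaleR_scaleR mult.commute[of "inverse (real (length L))"])
qed

lemma avg_in_convex:
  assumes "convex C" "L \<noteq> []" "\<And>x. f x \<in> C"
  shows "avg L f x \<in> C"
proof -
  have "(\<Sum>i<length L. (1 / real (length L)) *\<^sub>R f (x + L ! i)) \<in> C"
    using assms by (intro convex_sum) auto
  then show ?thesis
    by (simp only: avg_def scaleR_sum_right[symmetric] divide_inverse mult_1)
qed

lemma avg_linear: "bounded_linear h \<Longrightarrow> avg L (\<lambda>x. h (f x)) x = h (avg L f x)"
proof -
  assume "bounded_linear h"
  then interpret h: bounded_linear h .
  show ?thesis by (simp add: avg_def h.sum h.scaleR)
qed

lemma avg_add: "avg L (\<lambda>x. f x + g x) x = avg L f x + avg L g x"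
  by (simp add: avg_def sum.distrib scaleR_add_right)

lemma avg_diff: "avg L (\<lambda>x. f x - g x) x = avg L f x - avg L g x"
  by (simp add: avg_def sum_subtractf scaleR_diff_right)

lemma avg_dist_le:
  assumes "L \<noteq> []" "\<And>x. dist (f x) c \<le> e"
  shows "dist (avg L f x) c \<le> e"
  using avg_in_convex[of "cball c e" L f x] assms by (simp add: dist_commute)

lemma continuous_on_avg:
  fixes f :: "'x::topological_ab_group_add \<Rightarrow> 'b::real_normed_vector"
  shows "continuous_on UNIV f \<Longrightarrow> continuous_on UNIV (avg L f)"
  unfolding avg_def
  by (rule continuous_on_scaleR[OF continuous_on_const continuous_on_sum], rule continuous_on_compose2[of UNIV f])
     (auto intro!: continuous_intros)

definition osc_le :: "('a \<Rightarrow> real) \<Rightarrow> real \<Rightarrow> bool" where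
  "osc_le f e \<longleftrightarrow> (\<forall>x y. f x \<le> f y + e)"

text \<open>As long as the oscillation is at least \<open>e\<close>, averaging over one fixed net
  \<open>A\<close> lowers it by a fixed \<open>d > 0\<close>: some translate by the net comes close
  to a minimum point of the current average. Since \<open>d\<close> depends only on \<open>f\<close>
  and \<open>e\<close>, finitely many rounds suffice.\<close>

lemma ex_avg_osc_le:
  fixes f :: "'x::topological_ab_group_add \<Rightarrow> real"
  assumes cpt: "compact (UNIV :: 'x set)" and f: "continuous_on UNIV f" and e: "e > 0"
  shows "\<exists>L. L \<noteq> [] \<and> osc_le (avg L f) e"
proof -
  have "\<forall>\<^sub>F u in nhds 0. u \<in> {u. \<forall>z. dist (f (z + u)) (f z) < e / 2}"
    using eventually_uniform_translate[OF cpt f, of "e / 2"] e by simp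
  then obtain A where A: "A \<noteq> []" "\<And>x. \<exists>a\<in>set A. x - a \<in> {u. \<forall>z. dist (f (z + u)) (f z) < e / 2}"
    by (rule finite_translate_cover[OF cpt]) blast
  define N where "N = length A"
  have "N > 0" using A by (simp add: N_def)
  \<comment> \<open>One of the \<open>N\<close> summands is at most the minimum plus
    \<open>e / 2\<close> instead of the minimum plus \<open>D\<close>, and \<open>D \<ge> e\<close>,
    so the average gains at least \<open>e / 2\<close> divided by \<open>N\<close>.\<close>
  define d where "d = e / (2 * N)"
  have "d > 0" using e \<open>N > 0\<close> by (simp add: d_def)
  have step: "osc_le (avg A (avg L f)) (D - d)"
    if L: "L \<noteq> []" and D: "osc_le (avg L f) D" "D \<ge> e" for L D
  proof -
    let ?g = "avg L f"
    have cg: "continuous_on UNIV ?g" by (rule continuous_on_avg[OF f])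
    obtain x0 where x0: "\<And>x. ?g x0 \<le> ?g x"
      using continuous_attains_inf[OF cpt _ cg] by auto
    have lo: "avg A ?g y \<ge> ?g x0" for y
      using avg_in_convex[of "{?g x0..}" A ?g y] A x0 by simp
    have hi: "avg A ?g x \<le> ?g x0 + D - d" for x
    proof -
      obtain i where i: "i < length A" "\<forall>z. dist (f (z + (x0 - x - A ! i))) (f z) < e / 2"
        using A(2)[of "x0 - x"] by (auto simp: in_set_conv_nth)
      \<comment> \<open>Averaging commutes with translation, so \<open>avg L f\<close> inherits the
        modulus of continuity of \<open>f\<close>, whatever \<open>L\<close> is.\<close>
      have "dist (avg L (\<lambda>y. f (y + (x0 - x - A ! i)) - f y) (x + A ! i)) 0 \<le> e / 2"
        using i by (intro avg_dist_le L) (auto simp: dist_norm less_imp_le)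
      then have "dist (avg L f x0) (avg L f (x + A ! i)) \<le> e / 2"
        by (simp add: avg_diff dist_norm) (simp add: avg_def algebra_simps)
      then have 1: "?g (x + A ! i) \<le> ?g x0 + e / 2"
        unfolding dist_real_def by linarith
      have "(\<Sum>j<length A. ?g (x + A ! j)) = ?g (x + A ! i) + (\<Sum>j\<in>{..<length A} - {i}. ?g (x + A ! j))"
        using i by (subst sum.remove[of _ i]) auto
      also have "\<dots> \<le> (?g x0 + e / 2) + (\<Sum>j\<in>{..<length A} - {i}. ?g x0 + D)"
        using 1 D unfolding osc_le_def by (intro add_mono sum_mono) auto
      also have "\<dots> = (?g x0 + e / 2) + (real N - 1) * (?g x0 + D)"
        using i by (simp add: N_def of_nat_diff)
      also have "\<dots> \<le> N * (?g x0 + D) - e / 2"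
        using D by (simp add: algebra_simps)
      also have "\<dots> = N * (?g x0 + D - d)"
        using \<open>N > 0\<close> by (simp add: d_def algebra_simps)
      finally show ?thesis
        using \<open>N > 0\<close> by (simp add: avg_def N_def divide_inverse[symmetric] field_simps)
    qed
    show ?thesis unfolding osc_le_def
    proof (intro allI)
      fix x y show "avg A ?g x \<le> avg A ?g y + (D - d)" using hi[of x] lo[of y] by linarith
    qed
  qed
  obtain x1 where x1: "\<And>x. f x1 \<le> f x"
    using continuous_attains_inf[OF cpt _ f] by auto
  obtain x2 where x2: "\<And>x. f x \<le> f x2"
    using continuous_attains_sup[OF cpt _ f] by auto
  have "osc_le (avg [0] f) (f x2 - f x1)"
  proof -
    have "f x \<le> f y + (f x2 - f x1)" for x y using x1[of y] x2[of x] by linarith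
    then show ?thesis by (simp add: avg_def osc_le_def)
  qed
  \<comment> \<open>The \<open>max\<close> records that a round is only guaranteed to gain
    \<open>d\<close> while the bound is still at least \<open>e\<close>.\<close>
  then have *: "\<exists>L. L \<noteq> [] \<and> osc_le (avg L f) (max e (f x2 - f x1 - n * d))" for n :: nat
  proof (induction n)
    case 0
    then have "osc_le (avg [0] f) (max e (f x2 - f x1))"
      unfolding osc_le_def by (smt (verit))
    then show ?case by (intro exI[of _ "[0]"]) simp
  next
    case (Suc n)
    then obtain L where L: "L \<noteq> []" "osc_le (avg L f) (max e (f x2 - f x1 - n * d))"
      by auto
    have "osc_le (avg (list_sums A L) f) (max e (f x2 - f x1 - n * d) - d)"
      using step[OF L] by (simp add: avg_list_sums)
    moreover have "max e (f x2 - f x1 - n * d) - d \<le> max e (f x2 - f x1 - Suc n * d)"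
      using \<open>d > 0\<close> by (auto simp: max_def algebra_simps)
    ultimately have "osc_le (avg (list_sums A L) f) (max e (f x2 - f x1 - Suc n * d))"
      unfolding osc_le_def by (smt (verit))
    then show ?case using list_sums_ne[OF A(1) L(1)] by blast
  qed
  obtain n :: nat where "f x2 - f x1 < n * d"
    using reals_Archimedean3[OF \<open>d > 0\<close>] by blast
  then have "max e (f x2 - f x1 - n * d) = e" using e by (simp add: max_def)
  then show ?thesis using *[of n] by simp
qed

text \<open>For continuous real or complex \<open>f\<close> on a compact group, \<open>c\<close> is
  the integral of \<open>f\<close> against normalised Haar measure, described as a constant in the
  uniform closure of the averages of translates of \<open>f\<close>.\<close>

definition has_mean :: "('a::ab_group_add \<Rightarrow> 'b::real_normed_vector) \<Rightarrow> 'b \<Rightarrow> bool" where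
  "has_mean f c \<longleftrightarrow> (\<forall>e>0. \<exists>L. L \<noteq> [] \<and> (\<forall>x. dist (avg L f x) c \<le> e))"

definition mean :: "('a::ab_group_add \<Rightarrow> 'b::real_normed_vector) \<Rightarrow> 'b" where
  "mean f = (THE c. has_mean f c)"

text \<open>Averages over two lists commute, and averaging keeps a function close to a constant. The
  double average is therefore close to both \<open>c\<close> and \<open>d\<close>.\<close>

lemma has_mean_unique:
  assumes "has_mean f c" "has_mean f d" shows "c = d"
proof -
  have "dist c d \<le> 0 + e" if "e > 0" for e
  proof -
    obtain L where L: "L \<noteq> []" "\<And>x. dist (avg L f x) c \<le> e / 2"
      using assms(1) \<open>e > 0\<close> unfolding has_mean_def by (meson half_gt_zero)
    obtain L' where L': "L' \<noteq> []" "\<And>x. dist (avg L' f x) d \<le> e / 2"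
      using assms(2) \<open>e > 0\<close> unfolding has_mean_def by (meson half_gt_zero)
    have "dist (avg L' (avg L f) 0) c \<le> e / 2"
      by (rule avg_dist_le[OF L'(1) L(2)])
    moreover have "dist (avg L' (avg L f) 0) d \<le> e / 2"
      by (subst avg_commute) (rule avg_dist_le[OF L(1) L'(2)])
    ultimately show ?thesis
      using dist_triangle3[of c d "avg L' (avg L f) 0"] by simp
  qed
  then have "dist c d \<le> 0" by (rule field_le_epsilon)
  then show ?thesis by simp
qed

lemma mean_eqI: "has_mean f c \<Longrightarrow> mean f = c"
  unfolding mean_def using has_mean_unique by blast

lemma has_mean_avg:
  assumes "has_mean f c" "L \<noteq> []" shows "has_mean (avg L f) c"
  unfolding has_mean_def
proof (intro allI impI)
  fix e :: real assume "e > 0"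
  then obtain L' where "L' \<noteq> []" "\<And>x. dist (avg L' f x) c \<le> e"
    using assms unfolding has_mean_def by blast
  then show "\<exists>L'. L' \<noteq> [] \<and> (\<forall>x. dist (avg L' (avg L f) x) c \<le> e)"
    by (subst avg_commute) (meson avg_dist_le assms(2))
qed

lemma has_mean_translate: "has_mean f c \<Longrightarrow> has_mean (\<lambda>x. f (x + a)) c"
  using has_mean_avg[of f c "[a]"] by (simp add: avg_def[abs_def])

lemma has_mean_uminus:
  assumes "has_mean f c" shows "has_mean (\<lambda>x. f (- x)) c"
  unfolding has_mean_def
proof (intro allI impI)
  fix e :: real assume "e > 0"
  then obtain L where L: "L \<noteq> []" "\<And>x. dist (avg L f x) c \<le> e"
    using assms unfolding has_mean_def by blast
  have "avg (map uminus L) (\<lambda>x. f (- x)) x = avg L f (- x)" for x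
    by (simp add: avg_def)
  then show "\<exists>L. L \<noteq> [] \<and> (\<forall>x. dist (avg L (\<lambda>x. f (- x)) x) c \<le> e)"
    using L by (intro exI[of _ "map uminus L"]) simp
qed

text \<open>A single list must work for both functions. The combined list
  \<open>list_sums L' L\<close> does, because a further average preserves closeness to a
  constant.\<close>

lemma has_mean_add:
  assumes "has_mean f c" "has_mean g d" shows "has_mean (\<lambda>x. f x + g x) (c + d)"
  unfolding has_mean_def
proof (intro allI impI)
  fix e :: real assume "e > 0"
  obtain L where L: "L \<noteq> []" "\<And>x. dist (avg L f x) c \<le> e / 2"
    using assms(1) \<open>e > 0\<close> unfolding has_mean_def by (meson half_gt_zero)
  obtain L' where L': "L' \<noteq> []" "\<And>x. dist (avg L' g x) d \<le> e / 2"
    using assms(2) \<open>e > 0\<close> unfolding has_mean_def by (meson half_gt_zero)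
  have "dist (avg (list_sums L' L) (\<lambda>x. f x + g x) x) (c + d) \<le> e" for x
  proof -
    have "dist (avg L' (avg L f) x) c \<le> e / 2"
      by (rule avg_dist_le[OF L'(1) L(2)])
    moreover have "dist (avg L' (avg L g) x) d \<le> e / 2"
      by (subst avg_commute) (rule avg_dist_le[OF L(1) L'(2)])
    ultimately show ?thesis
      using dist_triangle_add[of "avg L' (avg L f) x" "avg L' (avg L g) x" c d]
      by (simp add: avg_add avg_list_sums[symmetric])
  qed
  then show "\<exists>L. L \<noteq> [] \<and> (\<forall>x. dist (avg L (\<lambda>x. f x + g x) x) (c + d) \<le> e)"
    using list_sums_ne[OF L'(1) L(1)] by blast
qed

lemma has_mean_linear:
  assumes "bounded_linear h" "has_mean f c" shows "has_mean (\<lambda>x. h (f x)) (h c)"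
  unfolding has_mean_def
proof (intro allI impI)
  fix e :: real assume "e > 0"
  obtain K where K: "K > 0" "\<And>x. norm (h x) \<le> norm x * K"
    using bounded_linear.pos_bounded[OF assms(1)] by blast
  obtain L where L: "L \<noteq> []" "\<And>x. dist (avg L f x) c \<le> e / K"
    using assms(2) \<open>e > 0\<close> K(1) unfolding has_mean_def by (meson divide_pos_pos)
  have "dist (avg L (\<lambda>x. h (f x)) x) (h c) \<le> e" for x
  proof -
    have "dist (avg L (\<lambda>x. h (f x)) x) (h c) = norm (h (avg L f x - c))"
      by (simp add: avg_linear assms(1) dist_norm bounded_linear.linear linear_diff)
    also have "\<dots> \<le> norm (avg L f x - c) * K" by (rule K)
    also have "\<dots> \<le> e / K * K"
      using L(2)[of x] K(1) by (intro mult_right_mono) (auto simp: dist_norm)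
    finally show ?thesis using K(1) by simp
  qed
  then show "\<exists>L. L \<noteq> [] \<and> (\<forall>x. dist (avg L (\<lambda>x. h (f x)) x) (h c) \<le> e)"
    using L(1) by blast
qed

lemma has_mean_const: "has_mean (\<lambda>_. c) c"
  unfolding has_mean_def by (auto intro!: exI[of _ "[0]"] simp: avg_def)

text \<open>Averages never leave \<open>C\<close>. Positivity and norm bounds of the mean are the
  cases of a half-line and of a ball.\<close>

lemma has_mean_in_closed_convex:
  assumes "has_mean f c" "closed C" "convex C" "\<And>x. f x \<in> C"
  shows "c \<in> C"
proof -
  have "\<exists>y\<in>C. dist y c < e" if "e > 0" for e
  proof -
    obtain L where L: "L \<noteq> []" "\<And>x. dist (avg L f x) c \<le> e / 2"
      using assms(1) \<open>e > 0\<close> unfolding has_mean_def by (meson half_gt_zero)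
    moreover have "avg L f 0 \<in> C"
      by (rule avg_in_convex[OF assms(3) L(1) assms(4)])
    ultimately show ?thesis
      using le_less_trans[OF L(2)[of 0], of e] \<open>e > 0\<close> by auto
  qed
  then show ?thesis using assms(2) closed_approachable by blast
qed

text \<open>The candidate is the supremum of all lower bounds of averages. Comparing two averages by
  commuting them shows that an average of oscillation at most \<open>e\<close> stays within
  \<open>e\<close> of this supremum.\<close>

lemma has_mean_real:
  fixes f :: "'x::topological_ab_group_add \<Rightarrow> real"
  assumes cpt: "compact (UNIV :: 'x set)" and f: "continuous_on UNIV f"
  shows "has_mean f (mean f)"
proof -
  define S where "S = {b. \<exists>L. L \<noteq> [] \<and> (\<forall>x. b \<le> avg L f x)}"
  have bound: "b \<le> avg L f y + e" if "b \<in> S" "L \<noteq> []" "osc_le (avg L f) e" for b L e y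
  proof -
    obtain L' where L': "L' \<noteq> []" "\<And>x. b \<le> avg L' f x" using \<open>b \<in> S\<close> by (auto simp: S_def)
    have "b \<le> avg L (avg L' f) 0"
      using avg_in_convex[of "{b..}" L "avg L' f" 0] that L' by simp
    also have "\<dots> = avg L' (avg L f) 0" by (simp add: avg_commute)
    also have "\<dots> \<le> avg L f y + e"
      using avg_in_convex[of "{..avg L f y + e}" L' "avg L f" 0] that L' by (simp add: osc_le_def)
    finally show ?thesis .
  qed
  have inS: "avg L f y - e \<in> S" if "L \<noteq> []" "osc_le (avg L f) e" for L e y
    using that unfolding S_def osc_le_def by (force simp: algebra_simps)
  obtain L1 where L1: "L1 \<noteq> []" "osc_le (avg L1 f) 1"
    using ex_avg_osc_le[OF cpt f, of 1] by auto
  have bdd: "bdd_above S" using bound[OF _ L1] by (auto simp: bdd_above_def)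
  have ne: "S \<noteq> {}" using inS[OF L1] by blast
  have "has_mean f (Sup S)"
    unfolding has_mean_def
  proof (intro allI impI)
    fix e :: real assume "e > 0"
    then obtain L where L: "L \<noteq> []" "osc_le (avg L f) e"
      using ex_avg_osc_le[OF cpt f] by blast
    have "dist (avg L f x) (Sup S) \<le> e" for x
      using cSup_upper[OF inS[OF L] bdd, of x] cSup_least[OF ne bound[OF _ L], of x]
      by (simp add: dist_real_def)
    then show "\<exists>L. L \<noteq> [] \<and> (\<forall>x. dist (avg L f x) (Sup S) \<le> e)" using L by blast
  qed
  then show ?thesis using mean_eqI by metis
qed

lemma has_mean_complex:
  fixes f :: "'x::topological_ab_group_add \<Rightarrow> complex"
  assumes cpt: "compact (UNIV :: 'x set)" and f: "continuous_on UNIV f"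
  shows "has_mean f (mean f)"
proof -
  obtain a b where ab: "has_mean (\<lambda>x. Re (f x)) a" "has_mean (\<lambda>x. Im (f x)) b"
    using has_mean_real[OF cpt] continuous_on_Re[OF f] continuous_on_Im[OF f] by blast
  have "has_mean (\<lambda>x. of_real (Re (f x)) + \<i> * of_real (Im (f x))) (of_real a + \<i> * of_real b)"
    by (intro has_mean_add has_mean_linear[OF _ ab(1)]
          has_mean_linear[OF bounded_linear_compose[OF bounded_linear_mult_right bounded_linear_of_real] ab(2)]
          bounded_linear_of_real)
  then have "has_mean f (of_real a + \<i> * of_real b)"
    by (simp add: complex_eq[symmetric])
  then show ?thesis using mean_eqI by metis
qed

section \<open>Convolution and autocorrelation\<close>

lemma compact_Pi_cball: "compact (Pi UNIV (\<lambda>_::nat. cball (0::complex) B))"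
proof -
  have "compactin (product_topology (\<lambda>_::nat. euclidean :: complex topology) UNIV) (PiE UNIV (\<lambda>_. cball 0 B))"
    by (subst compactin_PiE) auto
  then show ?thesis
    by (simp add: euclidean_product_topology PiE_UNIV_domain Pi_def)
qed

text \<open>The nets for the tolerances \<open>inverse (Suc m)\<close> together form a countable set
  \<open>D\<close>. Compactness of a countable product of discs gives a subsequence converging at
  each point of \<open>D\<close>, and equicontinuity makes it uniformly Cauchy on the whole
  group.\<close>

lemma Arzela_Ascoli_group:
  fixes F :: "nat \<Rightarrow> 'x::topological_ab_group_add \<Rightarrow> complex"
  assumes cpt: "compact (UNIV :: 'x set)" and bdd: "\<And>n x. cmod (F n x) \<le> B"
    and equi: "\<And>e. e > 0 \<Longrightarrow> \<forall>\<^sub>F u in nhds 0. \<forall>n z. dist (F n (z + u)) (F n z) < e"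
  obtains r q where "strict_mono r" "uniform_limit UNIV (\<lambda>n. F (r n)) q sequentially"
proof -
  have "\<exists>A. \<forall>x. \<exists>a\<in>set A. x - a \<in> {u. \<forall>n z. dist (F n (z + u)) (F n z) < inverse (real (Suc m))}" for m
  proof -
    have "\<forall>\<^sub>F u in nhds 0. u \<in> {u. \<forall>n z. dist (F n (z + u)) (F n z) < inverse (real (Suc m))}"
      using equi[of "inverse (real (Suc m))"] by simp
    then show ?thesis
      by (rule finite_translate_cover[OF cpt]) blast
  qed
  then obtain A where A: "\<And>m x. \<exists>a\<in>set (A m). \<forall>n z. dist (F n (z + (x - a))) (F n z) < inverse (real (Suc m))"
    unfolding mem_Collect_eq by metis
  define D where "D = (\<Union>m. set (A m))"
  have "D \<noteq> {}"
  proof -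
    obtain a where "a \<in> set (A 0)" using A[of 0 0] by blast
    then have "a \<in> D" unfolding D_def by blast
    then show ?thesis by blast
  qed
  have "countable D"
    unfolding D_def by (rule countable_UN) (auto intro: countable_finite)
  define d where "d = from_nat_into D"
  have range_d: "range d = D"
    unfolding d_def using \<open>D \<noteq> {}\<close> \<open>countable D\<close> by (rule range_from_nat_into)
  define G where "G = (\<lambda>n i. F n (d i))"
  have "seq_compact (Pi UNIV (\<lambda>_::nat. cball (0::complex) B))"
    by (rule compact_imp_seq_compact[OF compact_Pi_cball])
  moreover have "\<forall>n. G n \<in> Pi UNIV (\<lambda>_::nat. cball (0::complex) B)"
    using bdd by (auto simp: G_def)
  ultimately obtain l r where r: "strict_mono r" "(G \<circ> r) \<longlonglongrightarrow> l"
    unfolding seq_compact_def by blast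
  have "(\<lambda>n. F (r n) (d i)) \<longlonglongrightarrow> l i" for i
  proof -
    have "isCont (\<lambda>f. f i) l"
      using continuous_on_interior[OF continuous_on_product_coordinates[of i]] by simp
    from isCont_tendsto_compose[OF this r(2)] show ?thesis by (simp add: G_def o_def)
  qed
  then have Cau: "Cauchy (\<lambda>n. F (r n) a)" if "a \<in> D" for a
    using that range_d LIMSEQ_imp_Cauchy by (metis imageE)
  have "uniformly_Cauchy_on UNIV (\<lambda>n. F (r n))"
    unfolding uniformly_Cauchy_on_def
  proof (intro allI impI)
    fix e :: real assume "e > 0"
    then obtain m where m: "inverse (real (Suc m)) < e / 3"
      using reals_Archimedean[of "e / 3"] by auto
    have "\<forall>a\<in>set (A m). \<exists>M. \<forall>i\<ge>M. \<forall>j\<ge>M. dist (F (r i) a) (F (r j) a) < e / 3"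
      using Cau \<open>e > 0\<close> unfolding Cauchy_def D_def by (meson UN_I UNIV_I divide_pos_pos zero_less_numeral)
    then obtain M where M: "\<And>a i j. a \<in> set (A m) \<Longrightarrow> i \<ge> M a \<Longrightarrow> j \<ge> M a \<Longrightarrow> dist (F (r i) a) (F (r j) a) < e / 3"
      by metis
    define M' where "M' = Max (insert 0 (M ` set (A m)))"
    have M': "M a \<le> M'" if "a \<in> set (A m)" for a
      using that by (simp add: M'_def)
    have "dist (F (r i) x) (F (r j) x) < e" if "i \<ge> M'" "j \<ge> M'" for x i j
    proof -
      obtain a where a: "a \<in> set (A m)" "\<And>n z. dist (F n (z + (x - a))) (F n z) < inverse (real (Suc m))"
        using A by metis
      have "dist (F n x) (F n a) < e / 3" for n
        using a(2)[of n a] m by simp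
      moreover have "dist (F (r i) a) (F (r j) a) < e / 3"
        using M[OF a(1)] M'[OF a(1)] that by simp
      ultimately show ?thesis
        by (smt (verit, best) dist_commute dist_triangle field_sum_of_halves dist_triangle_third)
    qed
    then show "\<exists>M. \<forall>x\<in>UNIV. \<forall>m\<ge>M. \<forall>n\<ge>M. dist (F (r m) x) (F (r n) x) < e"
      by blast
  qed
  then have "uniformly_convergent_on UNIV (\<lambda>n. F (r n))"
    by (rule Cauchy_uniformly_convergent)
  then show thesis
    using that r(1) by (auto simp: uniformly_convergent_on_def)
qed

section \<open>Mean square, convolution and positive definite functions\<close>

definition normsq :: "('a::ab_group_add \<Rightarrow> complex) \<Rightarrow> real" where
  "normsq f = mean (\<lambda>x. (cmod (f x))\<^sup>2)"

definition conv :: "('a::ab_group_add \<Rightarrow> complex) \<Rightarrow> ('a \<Rightarrow> complex) \<Rightarrow> 'a \<Rightarrow> complex" where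
  "conv f g x = mean (\<lambda>y. f (x - y) * g y)"

text \<open>By invariance of the mean, for continuous \<open>f\<close> on a compact group this is
  the inner product of the translate of \<open>f\<close> by \<open>x\<close> with \<open>f\<close>:
  a positive definite function, that is, a diagonal matrix coefficient of the regular
  representation.\<close>

definition autocor :: "('a::ab_group_add \<Rightarrow> complex) \<Rightarrow> 'a \<Rightarrow> complex" where
  "autocor f = conv f (\<lambda>x. cnj (f (- x)))"

lemma continuous_on_shift:
  fixes f :: "'x::topological_ab_group_add \<Rightarrow> 'b::topological_space"
  assumes "continuous_on UNIV f"
  shows "continuous_on UNIV (\<lambda>x. f (x + a))" "continuous_on UNIV (\<lambda>x. f (x - a))"
    "continuous_on UNIV (\<lambda>x. f (a - x))" "continuous_on UNIV (\<lambda>x. f (- x))"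
    "continuous_on UNIV (\<lambda>x. f (- x + a))"
  by (rule continuous_on_compose2[OF assms]; auto intro!: continuous_intros)+

context
  assumes cpt: "compact (UNIV :: 'x::topological_ab_group_add set)"
begin

lemmas has_mean_c = has_mean_complex[OF cpt]
lemmas has_mean_r = has_mean_real[OF cpt]

lemma continuous_bounded:
  fixes f :: "'x \<Rightarrow> complex"
  assumes "continuous_on UNIV f" obtains B where "B > 0" "\<And>x. cmod (f x) \<le> B"
  using compact_imp_bounded[OF compact_continuous_image[OF assms cpt]]
  by (auto simp: bounded_pos)

lemma mean_add:
  fixes f g :: "'x \<Rightarrow> complex"
  assumes "continuous_on UNIV f" "continuous_on UNIV g"
  shows "mean (\<lambda>x. f x + g x) = mean f + mean g"
  by (rule mean_eqI[OF has_mean_add[OF has_mean_c[OF assms(1)] has_mean_c[OF assms(2)]]])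

lemma mean_cmul:
  fixes f :: "'x \<Rightarrow> complex"
  assumes "continuous_on UNIV f" shows "mean (\<lambda>x. c * f x) = c * mean f"
  by (rule mean_eqI[OF has_mean_linear[OF bounded_linear_mult_right has_mean_c[OF assms]]])

lemma mean_diff:
  fixes f g :: "'x \<Rightarrow> complex"
  assumes "continuous_on UNIV f" "continuous_on UNIV g"
  shows "mean (\<lambda>x. f x - g x) = mean f - mean g"
  using mean_add[of f "\<lambda>x. (-1) * g x"] mean_cmul[of g "-1"] assms
  by (simp add: continuous_on_minus)

lemma mean_cnj:
  fixes f :: "'x \<Rightarrow> complex"
  assumes "continuous_on UNIV f" shows "mean (\<lambda>x. cnj (f x)) = cnj (mean f)"
  by (rule mean_eqI[OF has_mean_linear[OF bounded_linear_cnj has_mean_c[OF assms]]])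

lemma mean_Re:
  fixes f :: "'x \<Rightarrow> complex"
  assumes "continuous_on UNIV f" shows "mean (\<lambda>x. Re (f x)) = Re (mean f)"
  by (rule mean_eqI[OF has_mean_linear[OF bounded_linear_Re has_mean_c[OF assms]]])

lemma mean_of_real:
  fixes f :: "'x \<Rightarrow> real"
  assumes "continuous_on UNIV f" shows "mean (\<lambda>x. complex_of_real (f x)) = of_real (mean f)"
  by (rule mean_eqI[OF has_mean_linear[OF bounded_linear_of_real has_mean_r[OF assms]]])

lemma mean_translate:
  fixes f :: "'x \<Rightarrow> complex"
  assumes "continuous_on UNIV f" shows "mean (\<lambda>x. f (x + a)) = mean f"
  by (rule mean_eqI[OF has_mean_translate[OF has_mean_c[OF assms]]])

lemma mean_reflect:
  fixes f :: "'x \<Rightarrow> complex"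
  assumes "continuous_on UNIV f" shows "mean (\<lambda>x. f (a - x)) = mean f"
  using mean_eqI[OF has_mean_uminus[OF has_mean_translate[OF has_mean_c[OF assms], of a]]]
  by (simp add: algebra_simps)

lemma mean_add_real:
  fixes f g :: "'x \<Rightarrow> real"
  assumes "continuous_on UNIV f" "continuous_on UNIV g"
  shows "mean (\<lambda>x. f x + g x) = mean f + mean g"
  by (rule mean_eqI[OF has_mean_add[OF has_mean_r[OF assms(1)] has_mean_r[OF assms(2)]]])

lemma mean_cmul_real:
  fixes f :: "'x \<Rightarrow> real"
  assumes "continuous_on UNIV f" shows "mean (\<lambda>x. c * f x) = c * mean f"
  by (rule mean_eqI[OF has_mean_linear[OF bounded_linear_mult_right has_mean_r[OF assms]]])

lemma mean_nonneg:
  fixes f :: "'x \<Rightarrow> real"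
  assumes "continuous_on UNIV f" "\<And>x. f x \<ge> 0" shows "mean f \<ge> 0"
  using has_mean_in_closed_convex[OF has_mean_r[OF assms(1)], of "{0..}"] assms(2) by simp

lemma mean_mono:
  fixes f g :: "'x \<Rightarrow> real"
  assumes "continuous_on UNIV f" "continuous_on UNIV g" "\<And>x. f x \<le> g x"
  shows "mean f \<le> mean g"
proof -
  have "mean (\<lambda>x. g x + (-1) * f x) \<ge> 0"
    using assms by (intro mean_nonneg continuous_intros) auto
  also have "mean (\<lambda>x. g x + (-1) * f x) = mean g + (-1) * mean f"
    using assms by (subst mean_add_real) (auto intro!: continuous_intros simp only: mean_cmul_real)
  finally show ?thesis by simp
qed

text \<open>\<open>f\<close> exceeds \<open>f x0 / 2\<close> near \<open>x0\<close>, and finitely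
  many translates of that neighbourhood cover the group. The average over them is bounded below by a
  positive constant and has the same mean.\<close>

lemma mean_pos:
  fixes f :: "'x \<Rightarrow> real"
  assumes f: "continuous_on UNIV f" and nonneg: "\<And>x. f x \<ge> 0" and pos: "f x0 > 0"
  shows "mean f > 0"
proof -
  have "\<forall>\<^sub>F u in nhds 0. \<forall>z. dist (f (z + u)) (f z) < f x0 / 2"
    using eventually_uniform_translate[OF cpt f, of "f x0 / 2"] pos by simp
  then have "\<forall>\<^sub>F u in nhds 0. u \<in> {u. f (x0 + u) > f x0 / 2}"
  proof eventually_elim
    case (elim u)
    then have "\<bar>f (x0 + u) - f x0\<bar> < f x0 / 2"
      by (simp add: dist_real_def)
    then have "f (x0 + u) > f x0 / 2" by linarith
    then show ?case by simp
  qed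
  then obtain A where A: "A \<noteq> []" "\<And>x. \<exists>a\<in>set A. x - a \<in> {u. f (x0 + u) > f x0 / 2}"
    by (rule finite_translate_cover[OF cpt]) blast
  \<comment> \<open>The cover places \<open>x - x0 - a\<close> in the neighbourhood for some
    \<open>a\<close> in \<open>A\<close>, which is a statement about \<open>f (x - a)\<close>; hence
    the negated list.\<close>
  have "avg (map uminus A) f x \<ge> f x0 / 2 / length A" for x
  proof -
    obtain i where i: "i < length A" "f (x0 + ((x - x0) - A ! i)) > f x0 / 2"
      using A(2)[of "x - x0"] by (auto simp: in_set_conv_nth)
    have "f x0 / 2 \<le> f (x + (- A ! i))"
      using i by simp
    also have "\<dots> \<le> (\<Sum>j<length A. f (x + (- A ! j)))"
      using i nonneg by (intro member_le_sum) auto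
    finally show ?thesis
      using A(1) by (simp add: avg_def divide_simps)
  qed
  moreover have "has_mean (avg (map uminus A) f) (mean f)"
    using A(1) by (intro has_mean_avg has_mean_r f) auto
  ultimately have "mean f \<ge> f x0 / 2 / length A"
    using has_mean_in_closed_convex[of "avg (map uminus A) f" "mean f" "{f x0 / 2 / length A..}"] by simp
  then show ?thesis
    using pos A(1) by (intro less_le_trans[OF _ \<open>mean f \<ge> _\<close>]) auto
qed

lemma norm_mean_le:
  fixes f :: "'x \<Rightarrow> complex"
  assumes "continuous_on UNIV f" "\<And>x. cmod (f x) \<le> B" shows "cmod (mean f) \<le> B"
  using has_mean_in_closed_convex[OF has_mean_c[OF assms(1)], of "cball 0 B"] assms(2) by simp

text \<open>Multiplying by \<open>c\<close> rotates the mean of \<open>f\<close> onto the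
  nonnegative real axis, after which real parts can be compared pointwise.\<close>

lemma norm_mean_le_mean:
  fixes f :: "'x \<Rightarrow> complex"
  assumes f: "continuous_on UNIV f" and g: "continuous_on UNIV g" and le: "\<And>x. cmod (f x) \<le> g x"
  shows "cmod (mean f) \<le> mean g"
proof -
  define c where "c = cnj (sgn (mean f))"
  have "cmod c \<le> 1"
    by (simp add: c_def norm_sgn)
  have "cnj (sgn z) * z = of_real (cmod z)" for z :: complex
  proof (cases "z = 0")
    case False
    have "cnj (sgn z) * z = z * cnj z / of_real (cmod z)"
      by (simp add: sgn_eq)
    also have "\<dots> = of_real (cmod z)"
      using False by (simp add: complex_norm_square[symmetric] power2_eq_square)
    finally show ?thesis .
  qed simp
  then have "cmod (mean f) = Re (c * mean f)"
    by (simp add: c_def)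
  also have "\<dots> = mean (\<lambda>x. Re (c * f x))"
    by (simp only: mean_Re[OF continuous_on_mult_left[OF f]] mean_cmul[OF f])
  also have "\<dots> \<le> mean g"
  proof (rule mean_mono)
    fix x
    have "Re (c * f x) \<le> cmod c * cmod (f x)"
      using complex_Re_le_cmod[of "c * f x"] by (simp add: norm_mult)
    also have "\<dots> \<le> 1 * g x"
      using \<open>cmod c \<le> 1\<close> le by (intro mult_mono) auto
    finally show "Re (c * f x) \<le> g x" by simp
  qed (use f g in \<open>auto intro!: continuous_intros\<close>)
  finally show ?thesis .
qed

lemma tendsto_mean:
  fixes F :: "nat \<Rightarrow> 'x \<Rightarrow> complex"
  assumes "uniform_limit UNIV F f sequentially" "\<And>n. continuous_on UNIV (F n)"
  shows "(\<lambda>n. mean (F n)) \<longlonglongrightarrow> mean f"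
proof (rule tendstoI)
  fix e :: real assume "e > 0"
  have f: "continuous_on UNIV f"
    by (rule uniform_limit_theorem[OF _ assms(1)]) (use assms(2) in auto)
  have "\<forall>\<^sub>F n in sequentially. \<forall>x\<in>UNIV. dist (F n x) (f x) < e / 2"
    using uniform_limitD[OF assms(1), of "e / 2"] \<open>e > 0\<close> by simp
  then show "\<forall>\<^sub>F n in sequentially. dist (mean (F n)) (mean f) < e"
  proof eventually_elim
    case (elim n)
    have "cmod (mean (\<lambda>x. F n x - f x)) \<le> e / 2"
      using elim f assms(2) by (intro norm_mean_le continuous_intros) (auto simp: dist_norm less_imp_le)
    then show ?case
      using f assms(2) \<open>e > 0\<close> by (simp add: mean_diff dist_norm)
  qed
qed

lemma normsq_complex:
  fixes f :: "'x \<Rightarrow> complex"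
  assumes "continuous_on UNIV f"
  shows "complex_of_real (normsq f) = mean (\<lambda>x. f x * cnj (f x))"
proof -
  have "continuous_on UNIV (\<lambda>x. (cmod (f x))\<^sup>2)"
    using assms by (intro continuous_intros)
  from mean_of_real[OF this] show ?thesis
    by (simp add: normsq_def complex_norm_square del: of_real_power)
qed

lemma normsq_nonneg:
  fixes f :: "'x \<Rightarrow> complex"
  shows "continuous_on UNIV f \<Longrightarrow> normsq f \<ge> 0"
  unfolding normsq_def by (intro mean_nonneg continuous_intros) auto

lemma normsq_pos:
  fixes f :: "'x \<Rightarrow> complex"
  assumes "continuous_on UNIV f" "f x \<noteq> 0" shows "normsq f > 0"
  unfolding normsq_def using assms by (intro mean_pos[of _ x] continuous_intros) auto

lemma normsq_le:
  fixes f :: "'x \<Rightarrow> complex"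
  assumes "continuous_on UNIV f" "\<And>x. cmod (f x) \<le> B" shows "normsq f \<le> B\<^sup>2"
proof -
  have "normsq f \<le> mean (\<lambda>x::'x. B\<^sup>2)"
    unfolding normsq_def using assms by (intro mean_mono continuous_intros power_mono) auto
  also have "\<dots> = B\<^sup>2" by (rule mean_eqI[OF has_mean_const])
  finally show ?thesis .
qed

lemma tendsto_normsq:
  fixes F :: "nat \<Rightarrow> 'x \<Rightarrow> complex"
  assumes lim: "uniform_limit UNIV F f sequentially" and cF: "\<And>n. continuous_on UNIV (F n)"
  shows "(\<lambda>n. normsq (F n)) \<longlonglongrightarrow> normsq f"
proof -
  have f: "continuous_on UNIV f"
    by (rule uniform_limit_theorem[OF _ lim]) (use cF in auto)
  have b: "bounded (f ` UNIV)"
    by (rule compact_imp_bounded[OF compact_continuous_image[OF f cpt]])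
  have lc: "uniform_limit UNIV (\<lambda>n x. cnj (F n x)) (\<lambda>x. cnj (f x)) sequentially"
    by (rule bounded_linear.uniform_limit[OF bounded_linear_cnj lim])
  have "bounded ((\<lambda>x. cnj (f x)) ` UNIV)"
    using b by (auto simp: bounded_iff)
  then have "uniform_limit UNIV (\<lambda>n x. F n x * cnj (F n x)) (\<lambda>x. f x * cnj (f x)) sequentially"
    by (intro uniform_lim_mult lim lc b)
  then have "(\<lambda>n. complex_of_real (normsq (F n))) \<longlonglongrightarrow> of_real (normsq f)"
    unfolding normsq_complex[OF f] normsq_complex[OF cF]
    by (rule tendsto_mean) (intro continuous_intros cF)
  then show ?thesis by (simp only: tendsto_of_real_iff)
qed

end

lemma conv_shift_left: "conv (\<lambda>y. f (y + s)) g x = conv f g (x + s)"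
  by (simp add: conv_def algebra_simps)

lemma autocor_eq: "autocor f x = mean (\<lambda>y. f (x - y) * cnj (f (- y)))"
  by (simp add: autocor_def conv_def)

context
  assumes cpt: "compact (UNIV :: 'x::topological_ab_group_add set)"
begin

lemma continuous_on_conv_arg:
  fixes f g :: "'x \<Rightarrow> complex"
  assumes "continuous_on UNIV f" "continuous_on UNIV g"
  shows "continuous_on UNIV (\<lambda>y. f (x - y) * g y)"
  by (intro continuous_on_mult continuous_on_shift assms)

lemma conv_commute:
  fixes f g :: "'x \<Rightarrow> complex"
  assumes "continuous_on UNIV f" "continuous_on UNIV g"
  shows "conv f g x = conv g f x"
  using mean_reflect[OF cpt continuous_on_conv_arg[OF assms, of x], of x]
  by (simp add: conv_def mult.commute)

lemma conv_shift_right: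
  fixes f g :: "'x \<Rightarrow> complex"
  assumes "continuous_on UNIV f" "continuous_on UNIV g"
  shows "conv f (\<lambda>y. g (y + s)) x = conv f g (x + s)"
  using mean_translate[OF cpt continuous_on_conv_arg[OF assms, of "x + s"], of s]
  by (simp add: conv_def algebra_simps)

lemma conv_add_left:
  fixes f g h :: "'x \<Rightarrow> complex"
  assumes "continuous_on UNIV f" "continuous_on UNIV g" "continuous_on UNIV h"
  shows "conv (\<lambda>y. f y + g y) h x = conv f h x + conv g h x"
  using mean_add[OF cpt continuous_on_conv_arg continuous_on_conv_arg, OF assms(1,3,2,3), of x x]
  by (simp add: conv_def ring_distribs)

lemma conv_cmul_left:
  fixes f h :: "'x \<Rightarrow> complex"
  assumes "continuous_on UNIV f" "continuous_on UNIV h"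
  shows "conv (\<lambda>y. c * f y) h x = c * conv f h x"
  using mean_cmul[OF cpt continuous_on_conv_arg, OF assms, of c x]
  by (simp add: conv_def mult.assoc)

lemma conv_add_right:
  fixes f g h :: "'x \<Rightarrow> complex"
  assumes "continuous_on UNIV f" "continuous_on UNIV g" "continuous_on UNIV h"
  shows "conv h (\<lambda>y. f y + g y) x = conv h f x + conv h g x"
  using mean_add[OF cpt continuous_on_conv_arg continuous_on_conv_arg, OF assms(3,1,3,2), of x x]
  by (simp add: conv_def ring_distribs)

lemma conv_cmul_right:
  fixes f h :: "'x \<Rightarrow> complex"
  assumes "continuous_on UNIV f" "continuous_on UNIV h"
  shows "conv h (\<lambda>y. c * f y) x = c * conv h f x"
  using mean_cmul[OF cpt continuous_on_conv_arg, OF assms(2,1), of c x]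
  by (simp add: conv_def mult_ac)

lemma norm_conv_le:
  fixes f g :: "'x \<Rightarrow> complex"
  assumes "continuous_on UNIV f" "continuous_on UNIV g"
    and "\<And>x. cmod (f x) \<le> A" "\<And>x. cmod (g x) \<le> B"
  shows "cmod (conv f g x) \<le> A * B"
proof -
  have "A \<ge> 0" using assms(3)[of 0] norm_ge_zero order_trans by blast
  then show ?thesis
    unfolding conv_def using assms
    by (intro norm_mean_le[OF cpt] continuous_on_conv_arg) (auto simp: norm_mult intro!: mult_mono)
qed

text \<open>The increment of \<open>conv f k\<close> is the convolution of \<open>f\<close> with the
  increment of \<open>k\<close>, so one neighbourhood works for all \<open>f\<close> bounded by
  \<open>B\<close>. This supplies the equicontinuity for the compactness argument.\<close>

lemma conv_equicontinuous:
  fixes k :: "'x \<Rightarrow> complex"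
  assumes k: "continuous_on UNIV k" and "e > 0"
  shows "\<forall>\<^sub>F u in nhds 0. \<forall>f. continuous_on UNIV f \<longrightarrow> (\<forall>x. cmod (f x) \<le> B) \<longrightarrow>
    (\<forall>z. dist (conv f k (z + u)) (conv f k z) < e)"
proof -
  \<comment> \<open>The summand 1 keeps the denominator positive for every real
    \<open>B\<close>.\<close>
  define d where "d = e / (2 * (\<bar>B\<bar> + 1))"
  have "d > 0" using \<open>e > 0\<close> by (simp add: d_def)
  have dB: "d * \<bar>B\<bar> < e"
  proof -
    have "d * \<bar>B\<bar> \<le> d * (\<bar>B\<bar> + 1)" using \<open>d > 0\<close> by (intro mult_left_mono) auto
    also have "\<dots> = e / 2" unfolding d_def by (simp add: field_simps)
    finally show ?thesis using \<open>e > 0\<close> by simp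
  qed
  from eventually_uniform_translate[OF cpt k \<open>d > 0\<close>] show ?thesis
  proof eventually_elim
    case (elim u)
    show ?case
    proof (intro allI impI)
      fix f :: "'x \<Rightarrow> complex" and z
      assume f: "continuous_on UNIV f" and B: "\<forall>x. cmod (f x) \<le> B"
      have ck: "continuous_on UNIV (\<lambda>y. k (y + u))" by (rule continuous_on_shift[OF k])
      have "conv f k (z + u) - conv f k z = conv (\<lambda>y. k (y + u) + (-1) * k y) f z"
        using k f ck by (simp only: conv_add_left conv_cmul_left conv_shift_left continuous_on_mult_left
              conv_commute[OF f k]) simp
      also have "cmod \<dots> \<le> d * \<bar>B\<bar>"
      proof (rule norm_conv_le[OF _ f])
        show "continuous_on UNIV (\<lambda>y. k (y + u) + - 1 * k y)"
          using k ck by (intro continuous_intros)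
        show "cmod (k (x + u) + - 1 * k x) \<le> d" for x
          using elim by (simp add: dist_norm less_imp_le)
        show "cmod (f x) \<le> \<bar>B\<bar>" for x
          using B[rule_format, of x] by linarith
      qed
      finally show "dist (conv f k (z + u)) (conv f k z) < e"
        using dB by (simp add: dist_norm)
    qed
  qed
qed

lemma continuous_on_conv:
  fixes f k :: "'x \<Rightarrow> complex"
  assumes f: "continuous_on UNIV f" and k: "continuous_on UNIV k"
  shows "continuous_on UNIV (conv f k)"
proof -
  obtain B where B: "\<And>x. cmod (f x) \<le> B" using continuous_bounded[OF cpt f] by blast
  have "(conv f k \<longlongrightarrow> conv f k x) (at x)" for x
  proof (rule tendstoI)
    fix e :: real assume "e > 0"
    have "\<forall>\<^sub>F u in nhds 0. dist (conv f k (x + u)) (conv f k x) < e"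
      using conv_equicontinuous[OF k \<open>e > 0\<close>, of B] by eventually_elim (use f B in blast)
    moreover have "filterlim (\<lambda>y. y - x) (nhds 0) (at x)"
    proof -
      have "((\<lambda>y. y - x) \<longlongrightarrow> x - x) (at x)"
        by (intro tendsto_intros)
      then show ?thesis by simp
    qed
    ultimately have "\<forall>\<^sub>F y in at x. dist (conv f k (x + (y - x))) (conv f k x) < e"
      by (rule eventually_compose_filterlim)
    then show "\<forall>\<^sub>F y in at x. dist (conv f k y) (conv f k x) < e"
      by simp
  qed
  then show ?thesis by (simp add: continuous_on_def)
qed

lemma continuous_on_flip:
  fixes f :: "'x \<Rightarrow> complex"
  shows "continuous_on UNIV f \<Longrightarrow> continuous_on UNIV (\<lambda>x. cnj (f (- x)))"
  by (intro continuous_intros continuous_on_shift)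

lemma continuous_on_autocor:
  fixes f :: "'x \<Rightarrow> complex"
  shows "continuous_on UNIV f \<Longrightarrow> continuous_on UNIV (autocor f)"
  unfolding autocor_def by (intro continuous_on_conv continuous_on_flip)

lemma autocor_0:
  fixes f :: "'x \<Rightarrow> complex"
  assumes f: "continuous_on UNIV f"
  shows "autocor f 0 = of_real (normsq f)"
  using mean_reflect[OF cpt, of "\<lambda>x. f x * cnj (f x)" 0] f
  by (simp add: autocor_eq normsq_complex[OF cpt] continuous_intros)

text \<open>The arithmetic-geometric inequality bounds the integrand by half the sum of two squares,
  each of which has mean \<open>normsq f\<close> by reflection and translation invariance.\<close>

lemma norm_autocor_le:
  fixes f :: "'x \<Rightarrow> complex"
  assumes f: "continuous_on UNIV f"
  shows "cmod (autocor f x) \<le> normsq f"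
proof -
  have c: "continuous_on UNIV (\<lambda>y. (cmod (f (a - y)))\<^sup>2)" for a
    by (intro continuous_intros continuous_on_shift f)
  have n: "mean (\<lambda>y. (cmod (f (a - y)))\<^sup>2) = normsq f" for a
  proof -
    have "complex_of_real (mean (\<lambda>y. (cmod (f (a - y)))\<^sup>2)) = of_real (normsq f)"
      unfolding mean_of_real[OF cpt c, symmetric] normsq_def
      by (subst mean_of_real[OF cpt, symmetric], intro continuous_intros f)
         (rule mean_reflect[OF cpt], intro continuous_intros f)
    then show ?thesis by (simp only: of_real_eq_iff)
  qed
  have "cmod (autocor f x) \<le> mean (\<lambda>y. (1/2) * ((cmod (f (x - y)))\<^sup>2 + (cmod (f (0 - y)))\<^sup>2))"
    unfolding autocor_eq
  proof (rule norm_mean_le_mean[OF cpt])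
    show "continuous_on UNIV (\<lambda>y. f (x - y) * cnj (f (- y)))"
      by (intro continuous_intros continuous_on_shift f)
    show "continuous_on UNIV (\<lambda>y. (1/2) * ((cmod (f (x - y)))\<^sup>2 + (cmod (f (0 - y)))\<^sup>2))"
      by (intro continuous_intros c)
    show "cmod (f (x - y) * cnj (f (- y))) \<le> (1/2) * ((cmod (f (x - y)))\<^sup>2 + (cmod (f (0 - y)))\<^sup>2)" for y
      using sum_squares_bound[of "cmod (f (x - y))" "cmod (f (- y))"] by (simp add: norm_mult)
  qed
  also have "\<dots> = normsq f"
    by (subst mean_cmul_real[OF cpt], intro continuous_intros c, subst mean_add_real[OF cpt c c]) (simp only: n, simp)
  finally show ?thesis .
qed

lemma autocor_cmul:
  fixes f :: "'x \<Rightarrow> complex"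
  assumes "continuous_on UNIV f"
  shows "autocor (\<lambda>x. of_real a * f x) x = of_real (a\<^sup>2) * autocor f x"
  using mean_cmul[OF cpt, of "\<lambda>y. f (x - y) * cnj (f (- y))" "of_real (a\<^sup>2)"] continuous_on_shift[OF assms]
  by (simp add: autocor_eq power2_eq_square mult_ac continuous_intros)

text \<open>Expanding the product gives four terms. The two diagonal ones agree by translation
  invariance and \<open>c * cnj c = 1\<close>; the mixed ones are translates of
  \<open>autocor f\<close>.\<close>

lemma autocor_modulate:
  fixes f :: "'x \<Rightarrow> complex"
  assumes f: "continuous_on UNIV f" and c: "cmod c = 1"
  shows "autocor (\<lambda>x. (f x + c * f (x + s)) / 2) x =
    (2 * autocor f x + c * autocor f (x + s) + cnj c * autocor f (x - s)) / 4"
proof -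
  have cc: "c * cnj c = 1" using c by (simp add: complex_norm_square[symmetric])
  define F where "F a b y = f (a - y) * cnj (f (b - y))" for a b y
  have cF: "continuous_on UNIV (F a b)" for a b
    unfolding F_def by (intro continuous_intros continuous_on_shift f)
  have m: "mean (F (a + t) (b + t)) = mean (F a b)" for a b t
    using mean_translate[OF cpt cF, of "a + t" "b + t" t] by (simp add: F_def[abs_def])
  have "autocor (\<lambda>x. (f x + c * f (x + s)) / 2) x =
     mean (\<lambda>y. (1/4) * (F x 0 y + (c * cnj c) * F (x + s) s y + c * F (x + s) 0 y + cnj c * F x s y))"
    unfolding autocor_eq
    by (rule arg_cong[of _ _ mean]) (auto simp: F_def fun_eq_iff field_simps)
  also have "\<dots> = (1/4) * (mean (F x 0) + (c * cnj c) * mean (F (x + s) s) + c * mean (F (x + s) 0) + cnj c * mean (F x s))"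
    by (simp only: mean_cmul[OF cpt] mean_add[OF cpt] cF continuous_on_add continuous_on_mult_left)
  also have "mean (F (x + s) s) = mean (F x 0)" using m[of x s 0] by simp
  also have "mean (F x s) = mean (F (x - s) 0)" using m[of "x - s" s 0] by simp
  finally show ?thesis
    by (simp add: cc) (simp add: autocor_eq F_def[abs_def])
qed

text \<open>Substituting \<open>y + x\<close> for \<open>y\<close> exchanges the two
  factors.\<close>

lemma autocor_hermitian:
  fixes f :: "'x \<Rightarrow> complex"
  assumes f: "continuous_on UNIV f"
  shows "autocor f (- x) = cnj (autocor f x)"
proof -
  have c: "continuous_on UNIV (\<lambda>y. f (x - y) * cnj (f (- y)))"
    by (intro continuous_intros continuous_on_shift f)
  have c': "continuous_on UNIV (\<lambda>y. cnj (f (x - y)) * f (- y))"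
    by (intro continuous_intros continuous_on_shift f)
  have "cnj (autocor f x) = mean (\<lambda>y. cnj (f (x - y)) * f (- y))"
    by (simp add: autocor_eq mean_cnj[OF cpt c, symmetric])
  also have "\<dots> = mean (\<lambda>y. cnj (f (x - (y + x))) * f (- (y + x)))"
    using mean_translate[OF cpt c', of x] by simp
  also have "\<dots> = autocor f (- x)"
  proof -
    have "x - (y + x) = - y" "- (y + x) = - x - y" for y by simp_all
    then show ?thesis by (simp only: autocor_eq mult.commute)
  qed
  finally show ?thesis by simp
qed

end

section \<open>Characters separate points\<close>

context
  assumes cpt: "compact (UNIV :: 'x::topological_ab_group_add set)"
begin

text \<open>The mixed terms of \<open>autocor_modulate\<close> are linear in \<open>c\<close> and
  \<open>cnj c\<close>, so they cancel between \<open>c\<close> and \<open>- c\<close>. The second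
  identity is the first one at 0.\<close>

lemma autocor_split:
  fixes f :: "'x \<Rightarrow> complex"
  assumes f: "continuous_on UNIV f" and c: "cmod c = 1"
    and f1: "f1 = (\<lambda>x. (f x + c * f (x + s)) / 2)" and f2: "f2 = (\<lambda>x. (f x + (- c) * f (x + s)) / 2)"
  shows "autocor f x = autocor f1 x + autocor f2 x" "normsq f = normsq f1 + normsq f2"
proof -
  have cf: "continuous_on UNIV f1" "continuous_on UNIV f2"
    unfolding f1 f2 by (intro continuous_intros continuous_on_shift f; simp)+
  have *: "autocor f x = autocor f1 x + autocor f2 x" for x
  proof -
    have "cmod (- c) = 1" using c by simp
    then show ?thesis
      unfolding f1 f2 autocor_modulate[OF cpt f c] autocor_modulate[OF cpt f \<open>cmod (- c) = 1\<close>]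
      by (simp add: add_divide_distrib[symmetric])
  qed
  from this show "autocor f x = autocor f1 x + autocor f2 x" .
  have "complex_of_real (normsq f) = of_real (normsq f1 + normsq f2)"
    using *[of 0] by (simp add: autocor_0[OF cpt] f cf)
  then show "normsq f = normsq f1 + normsq f2"
    by (simp only: of_real_eq_iff)
qed

text \<open>Expresses the smoothed autocorrelation of one half of the splitting through translates
  of the smoothed autocorrelation of \<open>f\<close> alone, so that it passes to the limit without
  any convergence of \<open>f\<close> itself.\<close>

lemma conv_autocor_modulate:
  fixes f k :: "'x \<Rightarrow> complex"
  assumes f: "continuous_on UNIV f" and k: "continuous_on UNIV k" and c: "cmod c = 1"
  shows "conv (autocor (\<lambda>x. (f x + c * f (x + s)) / 2)) k x =
    (2 * conv (autocor f) k x + c * conv (autocor f) k (x + s) + cnj c * conv (autocor f) k (x - s)) / 4"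
proof -
  let ?p = "autocor f"
  note p = continuous_on_autocor[OF cpt f]
  have ps: "continuous_on UNIV (\<lambda>x. ?p (x + t))" for t by (rule continuous_on_shift[OF p])
  have "autocor (\<lambda>x. (f x + c * f (x + s)) / 2) =
      (\<lambda>y. (1/2) * ?p y + ((c/4) * ?p (y + s) + (cnj c / 4) * ?p (y + (- s))))"
    using autocor_modulate[OF cpt f c, of s] by (auto simp: fun_eq_iff field_simps)
  then have "conv (autocor (\<lambda>x. (f x + c * f (x + s)) / 2)) k x =
     (1/2) * conv ?p k x + ((c/4) * conv (\<lambda>y. ?p (y + s)) k x + (cnj c / 4) * conv (\<lambda>y. ?p (y + (- s))) k x)"
    by (simp only: conv_add_left[OF cpt] conv_cmul_left[OF cpt] p ps k continuous_on_add continuous_on_mult_left)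
  then show ?thesis
    unfolding conv_shift_left[of ?p s k x] conv_shift_left[of ?p "- s" k x]
    by (simp add: field_simps)
qed

section \<open>The extremal problem for smoothed autocorrelations\<close>

text \<open>A quantitative form of extremality: if \<open>f\<close> nearly attains the bound
  \<open>m\<close>, then in mean square the image of the half \<open>f1\<close> is nearly its weight
  \<open>normsq f1\<close> times the image of \<open>f\<close>. The weight enters \<open>m\<close>
  squared because the image is quadratic in the function.\<close>

lemma extremal_inequality:
  fixes f k :: "'x \<Rightarrow> complex"
  assumes k: "continuous_on UNIV k" and f: "continuous_on UNIV f" "normsq f = 1"
    and m: "\<And>g :: 'x \<Rightarrow> complex. continuous_on UNIV g \<Longrightarrow> normsq (conv (autocor g) k) \<le> m * (normsq g)\<^sup>2"
    and c: "cmod c = 1" and f1: "f1 = (\<lambda>x. (f x + c * f (x + s)) / 2)"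
  shows "0 \<le> normsq f1" "normsq f1 \<le> 1"
    "normsq (\<lambda>x. conv (autocor f1) k x - of_real (normsq f1) * conv (autocor f) k x)
      \<le> m - normsq (conv (autocor f) k)"
proof -
  define f2 where f2: "f2 = (\<lambda>x. (f x + (- c) * f (x + s)) / 2)"
  have cf: "continuous_on UNIV f1" "continuous_on UNIV f2"
    unfolding f1 f2 by (intro continuous_intros continuous_on_shift f; simp)+
  define u v where "u = conv (autocor f1) k" and "v = conv (autocor f2) k"
  have cu: "continuous_on UNIV u" and cv: "continuous_on UNIV v"
    unfolding u_def v_def by (intro continuous_on_conv[OF cpt] continuous_on_autocor[OF cpt] cf k)+
  define a b where "a = normsq f1" and "b = normsq f2"
  have ab: "a \<ge> 0" "b \<ge> 0" "a + b = 1"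
    using autocor_split(2)[OF f(1) c f1 f2] f(2) normsq_nonneg[OF cpt cf(1)] normsq_nonneg[OF cpt cf(2)]
    by (simp_all add: a_def b_def)
  then show "0 \<le> normsq f1" "normsq f1 \<le> 1" by (simp_all add: a_def)
  have "autocor f = (\<lambda>x. autocor f1 x + autocor f2 x)"
    using autocor_split(1)[OF f(1) c f1 f2] by (simp add: fun_eq_iff)
  then have q: "conv (autocor f) k = (\<lambda>x. u x + v x)"
    by (simp only: u_def v_def conv_add_left[OF cpt continuous_on_autocor[OF cpt cf(1)] continuous_on_autocor[OF cpt cf(2)] k, symmetric])
  \<comment> \<open>The identity for weights with \<open>a + b = 1\<close>: the first term is the
    squared modulus of \<open>b u - a v\<close>, and its cross term cancels against that of
    \<open>a b\<close> times the squared modulus of \<open>u + v\<close>.\<close>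
  have pointwise: "(cmod (u x - of_real a * (u x + v x)))\<^sup>2 + a * b * (cmod (u x + v x))\<^sup>2 =
      b * (cmod (u x))\<^sup>2 + a * (cmod (v x))\<^sup>2" for x
  proof -
    have b: "b = 1 - a" using ab by simp
    show ?thesis
      unfolding cmod_power2 b by (simp add: power2_eq_square algebra_simps)
  qed
  have "normsq (\<lambda>x. u x - of_real a * (u x + v x)) + a * b * normsq (\<lambda>x. u x + v x) =
      mean (\<lambda>x. (cmod (u x - of_real a * (u x + v x)))\<^sup>2 + a * b * (cmod (u x + v x))\<^sup>2)"
    unfolding normsq_def using cu cv
    by (simp add: mean_add_real[OF cpt] mean_cmul_real[OF cpt] continuous_intros)
  also have "\<dots> = mean (\<lambda>x. b * (cmod (u x))\<^sup>2 + a * (cmod (v x))\<^sup>2)"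
    by (simp only: pointwise)
  also have "\<dots> = b * normsq u + a * normsq v"
    unfolding normsq_def using cu cv
    by (simp add: mean_add_real[OF cpt] mean_cmul_real[OF cpt] continuous_intros)
  also have "\<dots> \<le> b * (m * a\<^sup>2) + a * (m * b\<^sup>2)"
    using m[OF cf(1)] m[OF cf(2)] ab unfolding u_def v_def a_def b_def
    by (intro add_mono mult_left_mono) auto
  also have "\<dots> = a * b * m * (a + b)" by (simp add: power2_eq_square algebra_simps)
  also have "\<dots> = a * b * m" using ab by simp
  finally have 1: "normsq (\<lambda>x. u x - of_real a * (u x + v x)) \<le> a * b * (m - normsq (\<lambda>x. u x + v x))"
    by (simp add: algebra_simps)
  have "0 \<le> m - normsq (\<lambda>x. u x + v x)"
    using m[OF f(1)] by (simp add: f(2) q)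
  moreover have "a * b \<le> 1"
    using ab mult_mono[of a 1 b 1] by simp
  ultimately have "a * b * (m - normsq (\<lambda>x. u x + v x)) \<le> 1 * (m - normsq (\<lambda>x. u x + v x))"
    by (intro mult_right_mono)
  with 1 show "normsq (\<lambda>x. conv (autocor f1) k x - of_real (normsq f1) * conv (autocor f) k x)
      \<le> m - normsq (conv (autocor f) k)"
    by (simp add: q a_def[symmetric] u_def[symmetric])
qed

text \<open>\<open>m\<close> is the supremum over functions of mean square 1. The bound for general
  \<open>g\<close> follows by rescaling, as \<open>normsq (conv (autocor g) k)\<close> is
  homogeneous of degree 4.\<close>

lemma conv_autocor_bound:
  fixes k :: "'x \<Rightarrow> complex"
  assumes k: "continuous_on UNIV k"
  obtains m where "\<And>g :: 'x \<Rightarrow> complex. continuous_on UNIV g \<Longrightarrow> normsq (conv (autocor g) k) \<le> m * (normsq g)\<^sup>2"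
    "\<And>e. e > 0 \<Longrightarrow> \<exists>f :: 'x \<Rightarrow> complex. continuous_on UNIV f \<and> normsq f = 1 \<and> normsq (conv (autocor f) k) > m - e"
proof -
  obtain K where K: "\<And>x. cmod (k x) \<le> K" using continuous_bounded[OF cpt k] by blast
  define S where "S = {normsq (conv (autocor f) k) |f :: 'x \<Rightarrow> complex. continuous_on UNIV f \<and> normsq f = 1}"
  have le: "normsq (conv (autocor f) k) \<le> (normsq f * K)\<^sup>2" if f: "continuous_on UNIV f" for f :: "'x \<Rightarrow> complex"
    by (intro normsq_le[OF cpt] continuous_on_conv[OF cpt] norm_conv_le[OF cpt] continuous_on_autocor[OF cpt]
        norm_autocor_le[OF cpt] f k K)
  have bdd: "bdd_above S"
    unfolding S_def bdd_above_def using le by force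
  have "normsq (\<lambda>_::'x. 1) = 1"
    unfolding normsq_def by (rule mean_eqI) (use has_mean_const[of 1] in simp)
  then have ne: "S \<noteq> {}"
    unfolding S_def using continuous_on_const[of UNIV "1::complex"] by blast
  show thesis
  proof
    fix g :: "'x \<Rightarrow> complex" assume g: "continuous_on UNIV g"
    show "normsq (conv (autocor g) k) \<le> Sup S * (normsq g)\<^sup>2"
    proof (cases "normsq g = 0")
      case True
      then show ?thesis using le[OF g] by simp
    next
      case False
      then have pos: "normsq g > 0" using normsq_nonneg[OF cpt g] by simp
      define t where "t = 1 / sqrt (normsq g)"
      have t: "t\<^sup>2 = 1 / normsq g" using pos by (simp add: t_def power_divide)
      define f where "f = (\<lambda>x. of_real t * g x)"
      have f: "continuous_on UNIV f" unfolding f_def using g by (intro continuous_intros)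
      have af: "autocor f = (\<lambda>x. of_real (t\<^sup>2) * autocor g x)"
        unfolding f_def using autocor_cmul[OF cpt g] by (simp add: fun_eq_iff)
      have "complex_of_real (normsq f) = of_real (t\<^sup>2 * normsq g)"
        using fun_cong[OF af, of 0] by (simp add: autocor_0[OF cpt] f g)
      then have "normsq f = 1" using t pos by (simp only: of_real_eq_iff) simp
      then have "normsq (conv (autocor f) k) \<in> S" unfolding S_def using f by blast
      then have "normsq (conv (autocor f) k) \<le> Sup S" using bdd by (rule cSup_upper)
      moreover have "normsq (conv (autocor f) k) = t ^ 4 * normsq (conv (autocor g) k)"
      proof -
        have "conv (autocor f) k = (\<lambda>x. of_real (t\<^sup>2) * conv (autocor g) k x)"
          unfolding af by (intro ext conv_cmul_left[OF cpt] continuous_on_autocor[OF cpt] g k)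
        then have "normsq (conv (autocor f) k) = mean (\<lambda>x. t ^ 4 * (cmod (conv (autocor g) k x))\<^sup>2)"
          by (simp add: normsq_def norm_mult power_mult_distrib norm_power power_mult[symmetric] del: of_real_power)
        also have "\<dots> = t ^ 4 * normsq (conv (autocor g) k)"
          unfolding normsq_def
          by (intro mean_cmul_real[OF cpt] continuous_intros continuous_on_conv[OF cpt] continuous_on_autocor[OF cpt] g k)
        finally show ?thesis .
      qed
      moreover have "t ^ 4 = 1 / (normsq g)\<^sup>2"
        using t by (metis (no_types, lifting) numeral_Bit0 power2_eq_square power_add power_one_over)
      ultimately show ?thesis using pos by (simp add: field_simps)
    qed
  next
    fix e :: real assume "e > 0"
    then have "Sup S - e < Sup S" by simp
    then obtain y where "y \<in> S" "Sup S - e < y" using less_cSup_iff[OF ne bdd] by blast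
    then show "\<exists>f :: 'x \<Rightarrow> complex. continuous_on UNIV f \<and> normsq f = 1 \<and> normsq (conv (autocor f) k) > Sup S - e"
      unfolding S_def by blast
  qed
qed

text \<open>\<open>q\<close> is a uniform limit of images of a maximising sequence. Only the images
  converge, not the functions; \<open>extremal_inequality\<close> speaks of images alone and in the
  limit says that the image of each half is a multiple of \<open>q\<close>. The nonvanishing image
  of \<open>f0\<close> ensures \<open>m > 0\<close> and so \<open>q\<close> is not zero.\<close>

lemma extremal_eigenfunction:
  fixes k f0 :: "'x \<Rightarrow> complex"
  assumes k: "continuous_on UNIV k" and f0: "continuous_on UNIV f0" "conv (autocor f0) k z \<noteq> 0"
  obtains q F where "\<And>n :: nat. continuous_on UNIV (F n)"
    "uniform_limit UNIV (\<lambda>n. conv (autocor (F n)) k) q sequentially" "normsq q > 0"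
    "\<And>s. \<exists>\<gamma>. \<forall>x. q (x + s) = \<gamma> * q x"
proof -
  obtain m where m: "\<And>g :: 'x \<Rightarrow> complex. continuous_on UNIV g \<Longrightarrow> normsq (conv (autocor g) k) \<le> m * (normsq g)\<^sup>2"
    and m': "\<And>e. e > 0 \<Longrightarrow> \<exists>f :: 'x \<Rightarrow> complex. continuous_on UNIV f \<and> normsq f = 1 \<and> normsq (conv (autocor f) k) > m - e"
    using conv_autocor_bound[OF k] by blast
  define Q where "Q f = conv (autocor f) k" for f
  have cQ: "continuous_on UNIV (Q f)" if "continuous_on UNIV f" for f
    unfolding Q_def by (intro continuous_on_conv[OF cpt] continuous_on_autocor[OF cpt] k that)
  have "0 < normsq (Q f0)" using f0(2) by (intro normsq_pos[OF cpt cQ[OF f0(1)]]) (simp add: Q_def)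
  then have "0 < m * (normsq f0)\<^sup>2" using m[OF f0(1)] by (simp add: Q_def)
  then have "m > 0" by (simp add: zero_less_mult_iff)
  have "\<exists>f :: 'x \<Rightarrow> complex. continuous_on UNIV f \<and> normsq f = 1 \<and> normsq (Q f) > m - inverse (real (Suc n))" for n
    unfolding Q_def by (rule m') simp
  then obtain G :: "nat \<Rightarrow> 'x \<Rightarrow> complex" where G: "\<And>n. continuous_on UNIV (G n)" "\<And>n. normsq (G n) = 1"
    "\<And>n. normsq (Q (G n)) > m - inverse (real (Suc n))"
    by metis
  obtain K where K: "\<And>x. cmod (k x) \<le> K" using continuous_bounded[OF cpt k] by blast
  have a1: "cmod (autocor (G n) x) \<le> 1" for n x
    using norm_autocor_le[OF cpt G(1), of n x] G(2) by simp
  have "cmod (Q (G n) x) \<le> 1 * K" for n x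
    unfolding Q_def by (intro norm_conv_le[OF cpt] continuous_on_autocor[OF cpt] G k K a1)
  moreover have "\<forall>\<^sub>F u in nhds 0. \<forall>n z. dist (Q (G n) (z + u)) (Q (G n) z) < e" if "e > 0" for e
    using conv_equicontinuous[OF cpt k that, of 1]
    by eventually_elim (use a1 continuous_on_autocor[OF cpt G(1)] in \<open>auto simp: Q_def\<close>)
  ultimately obtain r q where r: "strict_mono r" and q: "uniform_limit UNIV (\<lambda>n. Q (G (r n))) q sequentially"
    by (rule Arzela_Ascoli_group[OF cpt])
  define F where "F n = G (r n)" for n
  have F: "\<And>n. continuous_on UNIV (F n)" "\<And>n. normsq (F n) = 1" and qF: "uniform_limit UNIV (\<lambda>n. Q (F n)) q sequentially"
    using G q by (simp_all add: F_def)
  have cq: "continuous_on UNIV q"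
    by (rule uniform_limit_theorem[OF _ qF]) (use cQ F in auto)
  have lower: "m - normsq (Q (F n)) \<le> inverse (real (Suc n))" for n
  proof -
    have "inverse (real (Suc (r n))) \<le> inverse (real (Suc n))"
      using seq_suble[OF r, of n] by (intro le_imp_inverse_le) auto
    then show ?thesis using G(3)[of "r n"] unfolding F_def by linarith
  qed
  have inv0: "(\<lambda>n. inverse (real (Suc n))) \<longlonglongrightarrow> 0"
    by (rule LIMSEQ_inverse_real_of_nat)
  have "(\<lambda>n. m - normsq (Q (F n))) \<longlonglongrightarrow> m - normsq q"
    by (intro tendsto_intros tendsto_normsq[OF cpt qF] cQ F)
  then have "m - normsq q \<le> 0"
    by (rule LIMSEQ_le[OF _ inv0]) (use lower in blast)
  then have "normsq q > 0" using \<open>m > 0\<close> by simp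
  have eig: "\<exists>a. \<forall>x. (2 * q x + c * q (x + s) + cnj c * q (x - s)) / 4 = a * q x" if c: "cmod c = 1" for c s
  proof -
    define F1 where "F1 n = (\<lambda>x. (F n x + c * F n (x + s)) / 2)" for n
    have cF1: "continuous_on UNIV (F1 n)" for n
      unfolding F1_def by (intro continuous_intros continuous_on_shift F) simp
    note ineq = extremal_inequality[OF k F m c F1_def, folded Q_def]
    have "seq_compact {0..1::real}" by (intro compact_imp_seq_compact) simp
    moreover have "\<forall>n. normsq (F1 n) \<in> {0..1}" using ineq(1,2) by auto
    \<comment> \<open>The weights of the halves are only known to lie in the unit interval, so a
      further subsequence is taken on which they converge to \<open>a\<close>.\<close>
    ultimately obtain a t where t: "strict_mono t" "((\<lambda>n. normsq (F1 n)) \<circ> t) \<longlonglongrightarrow> a"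
      unfolding seq_compact_def by meson
    have qt: "uniform_limit UNIV (\<lambda>n. Q (F (t n))) q sequentially"
      by (rule filterlim_compose[OF qF filterlim_subseq[OF t(1)]])
    have qts: "uniform_limit UNIV (\<lambda>n x. Q (F (t n)) (x + w)) (\<lambda>x. q (x + w)) sequentially" for w
      using qt unfolding uniform_limit_iff by (fast elim: eventually_mono)
    have bq: "bounded ((\<lambda>x. q (x + w)) ` UNIV)" for w
      by (rule compact_imp_bounded[OF compact_continuous_image[OF continuous_on_shift(1)[OF cq] cpt]])
    have at: "uniform_limit UNIV (\<lambda>n x::'x. complex_of_real (normsq (F1 (t n)))) (\<lambda>x. of_real a) sequentially"
      using t(2) by (simp add: uniform_limit_iff tendsto_iff o_def dist_norm norm_of_real flip: of_real_diff)
    \<comment> \<open>The limit of the images of the halves. All arguments have the form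
      \<open>x + w\<close>, so that \<open>qts\<close> applies to each summand.\<close>
    define U where "U = (\<lambda>x. (1/2) * q (x + 0) + ((c/4) * q (x + s) + (cnj c / 4) * q (x + (- s))))"
    have const: "uniform_limit UNIV (\<lambda>n x::'x. d * h n x) (\<lambda>x. d * g x) sequentially"
      if "uniform_limit UNIV h g sequentially" for d :: complex and h g
      using bounded_linear.uniform_limit[OF bounded_linear_mult_right that] .
    have Qsplit: "Q (F1 n) x = (1/2) * Q (F n) (x + 0) + ((c/4) * Q (F n) (x + s) + (cnj c / 4) * Q (F n) (x + (- s)))" for n x
      unfolding Q_def F1_def conv_autocor_modulate[OF F(1) k c] by (simp add: field_simps)
    have uU: "uniform_limit UNIV (\<lambda>n. Q (F1 (t n))) U sequentially"
      unfolding U_def Qsplit[abs_def] by (intro uniform_limit_add const qts)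
    have "uniform_limit UNIV (\<lambda>n x. Q (F1 (t n)) x - of_real (normsq (F1 (t n))) * Q (F (t n)) x)
      (\<lambda>x. U x - of_real a * q x) sequentially"
    proof (intro uniform_limit_minus uU uniform_lim_mult at qt)
      show "bounded (q ` UNIV)" using bq[of 0] by simp
    qed simp
    then have "(\<lambda>n. normsq (\<lambda>x. Q (F1 (t n)) x - of_real (normsq (F1 (t n))) * Q (F (t n)) x))
      \<longlonglongrightarrow> normsq (\<lambda>x. U x - of_real a * q x)"
      by (rule tendsto_normsq[OF cpt]) (intro continuous_intros cQ F cF1)
    moreover have "(\<lambda>n. inverse (real (Suc (t n)))) \<longlonglongrightarrow> 0"
      using LIMSEQ_subseq_LIMSEQ[OF inv0 t(1)] by (simp add: o_def)
    moreover have "normsq (\<lambda>x. Q (F1 (t n)) x - of_real (normsq (F1 (t n))) * Q (F (t n)) x) \<le> inverse (real (Suc (t n)))" for n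
      using ineq(3) lower order_trans by blast
    ultimately have "normsq (\<lambda>x. U x - of_real a * q x) \<le> 0"
      by (intro LIMSEQ_le) blast+
    moreover have "continuous_on UNIV (\<lambda>x. U x - of_real a * q x)"
      unfolding U_def by (intro continuous_intros continuous_on_shift(1) cq)
    ultimately have "U x - of_real a * q x = 0" for x
      using normsq_pos[OF cpt] by force
    then show ?thesis
      by (intro exI[of _ "of_real a"]) (auto simp: U_def field_simps)
  qed
  have "\<exists>\<gamma>. \<forall>x. q (x + s) = \<gamma> * q x" for s
  proof -
    obtain a where a: "\<And>x. (2 * q x + 1 * q (x + s) + cnj 1 * q (x - s)) / 4 = a * q x"
      using eig[of 1 s] by auto
    obtain b where b: "\<And>x. (2 * q x + \<i> * q (x + s) + cnj \<i> * q (x - s)) / 4 = b * q x"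
      using eig[of "\<i>" s] by auto
    \<comment> \<open>\<open>c = 1\<close> determines the sum of \<open>q (x + s)\<close> and
      \<open>q (x - s)\<close> as a multiple of \<open>q x\<close>, and \<open>c = \<i>\<close>
      determines their difference; solving gives \<open>q (x + s)\<close>.\<close>
    have "q (x + s) = (2 * a - 1 - \<i> * (2 * b - 1)) * q x" for x
    proof -
      have A: "q (x - s) = (4 * a - 2) * q x - q (x + s)"
        using a[of x] by (simp add: field_simps)
      have B: "\<i> * (q (x + s) - q (x - s)) = (4 * b - 2) * q x"
        using b[of x] by (simp add: field_simps)
      have "q (x + s) - q (x - s) = - \<i> * (\<i> * (q (x + s) - q (x - s)))"
        by (simp add: algebra_simps)
      also have "\<dots> = - \<i> * ((4 * b - 2) * q x)" by (simp only: B)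
      finally have "2 * q (x + s) = (4 * a - 2) * q x - \<i> * ((4 * b - 2) * q x)"
        by (simp add: A algebra_simps)
      also have "\<dots> = 2 * ((2 * a - 1 - \<i> * (2 * b - 1)) * q x)"
        by (simp add: algebra_simps)
      finally show ?thesis by simp
    qed
    then show ?thesis by blast
  qed
  then show thesis
    using that[of F q] F(1) qF \<open>normsq q > 0\<close> by (simp add: Q_def)
qed

end

section \<open>From eigenfunctions of translations to characters\<close>

text \<open>The eigenvalue of translation by \<open>y\<close> is \<open>q y / q 0\<close>, and
  composing translations multiplies eigenvalues. Boundedness on the compact group then forces
  modulus 1.\<close>

lemma pontryagin_dual_of_eigenfunction:
  fixes q :: "'x::topological_ab_group_add \<Rightarrow> complex"
  assumes cpt: "compact (UNIV :: 'x set)" and cq: "continuous_on UNIV q"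
    and z: "q z \<noteq> 0" and eig: "\<And>s. \<exists>\<gamma>. \<forall>x. q (x + s) = \<gamma> * q x"
  shows "q 0 \<noteq> 0" "(\<lambda>x. q x / q 0) \<in> pontryagin_dual"
proof -
  define \<phi> where "\<phi> = (\<lambda>x. q x / q 0)"
  have q0: "q 0 \<noteq> 0"
  proof
    assume "q 0 = 0"
    obtain c where "\<forall>x. q (x + z) = c * q x" using eig by blast
    then have "q (0 + z) = c * q 0" by blast
    then show False using z \<open>q 0 = 0\<close> by simp
  qed
  then show "q 0 \<noteq> 0" .
  have mult: "\<phi> (x + y) = \<phi> x * \<phi> y" for x y
  proof -
    obtain c where c: "\<And>x. q (x + y) = c * q x" using eig by blast
    have "c = q y / q 0" using c[of 0] q0 by simp
    then show ?thesis using c[of x] q0 by (simp add: \<phi>_def)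
  qed
  have c\<phi>: "continuous_on UNIV \<phi>" unfolding \<phi>_def using cq q0 by (intro continuous_intros) auto
  have "\<phi> 0 = 1" using q0 by (simp add: \<phi>_def)
  have "continuous_on UNIV (\<lambda>x. cmod (\<phi> x))" by (intro continuous_intros c\<phi>)
  then obtain w where w: "\<And>x. cmod (\<phi> x) \<le> cmod (\<phi> w)"
    using continuous_attains_sup[OF cpt] by blast
  \<comment> \<open>At the point \<open>w\<close> of maximal modulus, doubling squares the modulus
    and cannot exceed the maximum; so the maximum is at most 1, and inverses turn this into equality
    everywhere.\<close>
  have "cmod (\<phi> w) * cmod (\<phi> w) \<le> cmod (\<phi> w)"
    using w[of "w + w"] by (simp add: mult norm_mult)
  moreover have "cmod (\<phi> w) > 0" using w[of 0] \<open>\<phi> 0 = 1\<close> by (auto intro: less_le_trans[OF zero_less_one])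
  ultimately have "cmod (\<phi> w) \<le> 1" by simp
  then have le: "cmod (\<phi> x) \<le> 1" for x using w order_trans by blast
  have "cmod (\<phi> x) = 1" for x
  proof -
    have "cmod (\<phi> x) * cmod (\<phi> (- x)) = 1"
      using mult[of x "- x"] \<open>\<phi> 0 = 1\<close> by (simp add: norm_mult[symmetric])
    moreover have "cmod (\<phi> x) * cmod (\<phi> (- x)) \<le> cmod (\<phi> x) * 1"
      using le by (intro mult_left_mono) auto
    ultimately show ?thesis using le[of x] by simp
  qed
  then show "(\<lambda>x. q x / q 0) \<in> pontryagin_dual"
    using c\<phi> mult unfolding pontryagin_dual_def \<phi>_def by blast
qed

text \<open>The kernel \<open>k\<close> is chosen as a difference \<open>l x - l (x + a)\<close>.
  Every \<open>conv p k\<close> is then orthogonal to all \<open>a\<close>-invariant functions. An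
  \<open>a\<close>-invariant \<open>q\<close> would, as a limit of such convolutions, be orthogonal
  to itself.\<close>

theorem pontryagin_dual_separates:
  fixes h :: "'x::topological_ab_group_add \<Rightarrow> complex"
  assumes cpt: "compact (UNIV :: 'x set)" and h: "continuous_on UNIV h" and ne: "h a \<noteq> h 0"
  obtains \<phi> where "\<phi> \<in> pontryagin_dual" "\<phi> a \<noteq> 1"
proof -
  \<comment> \<open>Taking the difference before the autocorrelation makes \<open>k\<close> both a
    difference by \<open>a\<close> and Hermitian with \<open>k 0 \<noteq> 0\<close>.\<close>
  define g where "g = (\<lambda>x. h x + (- 1) * h (x + a))"
  define t where "t = (\<lambda>x. cnj (g (- x)))"
  define k where "k = autocor g"
  define l where "l = conv h t"
  have ha: "continuous_on UNIV (\<lambda>x. h (x + a))" by (rule continuous_on_shift(1)[OF h])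
  have g: "continuous_on UNIV g" unfolding g_def by (intro continuous_intros h ha)
  have t: "continuous_on UNIV t" unfolding t_def by (rule continuous_on_flip[OF cpt g])
  have k: "continuous_on UNIV k" unfolding k_def by (rule continuous_on_autocor[OF cpt g])
  have l: "continuous_on UNIV l" unfolding l_def by (rule continuous_on_conv[OF cpt h t])
  have la: "continuous_on UNIV (\<lambda>x. l (x + a))" by (rule continuous_on_shift(1)[OF l])
  have kl: "k = (\<lambda>x. l x + (- 1) * l (x + a))"
  proof
    fix x
    have "k x = conv (\<lambda>x. h x + (- 1) * h (x + a)) t x"
      by (simp add: k_def autocor_def t_def g_def)
    also have "\<dots> = conv h t x + (- 1) * conv (\<lambda>x. h (x + a)) t x"
      by (simp only: conv_add_left[OF cpt h _ t] conv_cmul_left[OF cpt ha t] continuous_on_mult_left ha)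
    also have "\<dots> = l x + (- 1) * l (x + a)"
      unfolding conv_shift_left[of h a t x] l_def ..
    finally show "k x = l x + (- 1) * l (x + a)" .
  qed
  have "g 0 \<noteq> 0" using ne by (simp add: g_def)
  then have "normsq g > 0" by (rule normsq_pos[OF cpt g])
  then have "k 0 \<noteq> 0" by (simp add: k_def autocor_0[OF cpt g])
  then have "normsq k > 0" by (rule normsq_pos[OF cpt k])
  \<comment> \<open>As \<open>k\<close> is itself the autocorrelation of \<open>g\<close>, Hermitian
    symmetry turns \<open>conv k k\<close> at 0 into the mean square of \<open>k\<close>. So
    \<open>g\<close> is the required function with nonvanishing image.\<close>
  moreover have "conv (autocor g) k 0 = of_real (normsq k)"
    unfolding normsq_complex[OF cpt k] conv_def
    by (simp add: k_def autocor_hermitian[OF cpt g] mult.commute)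
  ultimately have "conv (autocor g) k 0 \<noteq> 0" by simp
  then obtain q F where F: "\<And>n :: nat. continuous_on UNIV (F n)"
    and lim: "uniform_limit UNIV (\<lambda>n. conv (autocor (F n)) k) q sequentially"
    and q: "normsq q > 0" "\<And>s. \<exists>\<gamma>. \<forall>x. q (x + s) = \<gamma> * q x"
    using extremal_eigenfunction[OF cpt k g] by metis
  have cQ: "continuous_on UNIV (conv (autocor (F n)) k)" for n
    by (intro continuous_on_conv[OF cpt] continuous_on_autocor[OF cpt] F k)
  have cq: "continuous_on UNIV q"
    by (rule uniform_limit_theorem[OF _ lim]) (use cQ in auto)
  have "\<exists>z. q z \<noteq> 0"
  proof (rule ccontr)
    assume "\<nexists>z. q z \<noteq> 0"
    then have "normsq q \<le> 0\<^sup>2" by (intro normsq_le[OF cpt cq]) auto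
    then show False using q(1) by simp
  qed
  then obtain z where z: "q z \<noteq> 0" by blast
  note \<phi> = pontryagin_dual_of_eigenfunction[OF cpt cq z q(2)]
  have "q a / q 0 \<noteq> 1"
  proof
    assume "q a / q 0 = 1"
    then have "q a = q 0" using \<phi>(1) by simp
    obtain c where c: "\<And>x. q (x + a) = c * q x" using q(2) by blast
    have "c = 1" using c[of 0] \<open>q a = q 0\<close> \<phi>(1) by simp
    then have inv: "q (x + a) = q x" for x using c by simp
    \<comment> \<open>Since \<open>q\<close> is \<open>a\<close>-invariant, the integrand is the
      difference of \<open>w x * cnj (q x)\<close> and its translate by \<open>a\<close>, and the
      mean does not see translations.\<close>
    have "mean (\<lambda>x. conv (autocor (F n)) k x * cnj (q x)) = 0" for n
    proof -
      note p = continuous_on_autocor[OF cpt F, of n]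
      define w where "w = conv (autocor (F n)) l"
      have w: "continuous_on UNIV w" unfolding w_def by (rule continuous_on_conv[OF cpt p l])
      have cw: "continuous_on UNIV (\<lambda>x. w x * cnj (q x))" by (intro continuous_intros w cq)
      have "conv (autocor (F n)) k x = w x + (- 1) * w (x + a)" for x
        unfolding kl w_def
        by (simp only: conv_add_right[OF cpt l _ p] conv_cmul_right[OF cpt la p] continuous_on_mult_left la
              conv_shift_right[OF cpt p l])
      then have "mean (\<lambda>x. conv (autocor (F n)) k x * cnj (q x)) =
          mean (\<lambda>x. w x * cnj (q x) - w (x + a) * cnj (q (x + a)))"
        by (simp add: inv left_diff_distrib)
      also have "\<dots> = 0"
        by (simp add: mean_diff[OF cpt cw continuous_on_shift(1)[OF cw]] mean_translate[OF cpt cw])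
      finally show ?thesis .
    qed
    moreover have "(\<lambda>n. mean (\<lambda>x. conv (autocor (F n)) k x * cnj (q x))) \<longlonglongrightarrow> mean (\<lambda>x. q x * cnj (q x))"
    proof (rule tendsto_mean[OF cpt])
      have "bounded ((\<lambda>x. cnj (q x)) ` UNIV)" "bounded (q ` UNIV)"
        using cq by (intro compact_imp_bounded compact_continuous_image[OF _ cpt] continuous_intros; simp)+
      then show "uniform_limit UNIV (\<lambda>n x. conv (autocor (F n)) k x * cnj (q x)) (\<lambda>x. q x * cnj (q x)) sequentially"
        by (intro uniform_lim_mult lim uniform_limit_const) auto
    qed (intro continuous_intros cQ cq)
    ultimately have "mean (\<lambda>x. q x * cnj (q x)) = 0"
      by (simp add: LIMSEQ_const_iff)
    then show False using q(1) normsq_complex[OF cpt cq] by simp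
  qed
  then show thesis using that[OF \<phi>(2)] by simp
qed

section \<open>Linear estimates\<close>

text \<open>Summing the inequality over all of \<open>G\<close> would compare a total with itself,
  which says nothing if it is infinite. The suprema \<open>\<sigma> n\<close> over sets of at most
  \<open>n\<close> elements are finite by the bound \<open>B\<close> and respect translations, as
  these preserve cardinality; the resulting bound does not depend on \<open>n\<close>.\<close>

lemma summable_of_contraction:
  fixes u c :: "'g::group_add \<Rightarrow> real"
  assumes "finite S" and c: "\<And>s. s \<in> S \<Longrightarrow> 0 \<le> c s" "(\<Sum>s\<in>S. c s) < 1"
    and u: "\<And>t. 0 \<le> u t" "\<And>t. u t \<le> B"
    and E: "finite E" "\<And>t. t \<notin> E \<Longrightarrow> u t \<le> (\<Sum>s\<in>S. c s * u (s + t))"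
  shows "u summable_on UNIV"
proof -
  define C where "C = (\<Sum>s\<in>S. c s)"
  define W where "W = sum u E"
  define \<sigma> where "\<sigma> n = Sup (sum u ` {G. finite G \<and> card G \<le> n})" for n
  have "B \<ge> 0" using u order_trans by blast
  have bdd: "bdd_above (sum u ` {G. finite G \<and> card G \<le> n})" for n
  proof (rule bdd_aboveI2)
    fix G :: "'g set" assume G: "G \<in> {G. finite G \<and> card G \<le> n}"
    have "sum u G \<le> card G * B" using u(2) by (intro sum_bounded_above)
    also have "\<dots> \<le> n * B" using G \<open>B \<ge> 0\<close> by (intro mult_right_mono) auto
    finally show "sum u G \<le> n * B" .
  qed
  have up: "sum u G \<le> \<sigma> n" if "finite G" "card G \<le> n" for G n
    unfolding \<sigma>_def using that by (intro cSup_upper bdd) auto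
  have step: "sum u G \<le> W + C * \<sigma> n" if G: "finite G" "card G \<le> n" for G n
  proof -
    have "sum u G \<le> W + sum u (G - E)"
    proof -
      have "sum u G = sum u (G \<inter> E) + sum u (G - E)"
        using sum.Int_Diff[OF G(1), of u E] .
      also have "sum u (G \<inter> E) \<le> W" unfolding W_def using E(1) u by (intro sum_mono2) auto
      finally show ?thesis by simp
    qed
    also have "sum u (G - E) \<le> (\<Sum>t\<in>G - E. \<Sum>s\<in>S. c s * u (s + t))"
      using E(2) by (intro sum_mono) auto
    also have "\<dots> = (\<Sum>s\<in>S. c s * (\<Sum>t\<in>G - E. u (s + t)))"
      by (subst sum.swap) (simp add: sum_distrib_left)
    also have "\<dots> \<le> (\<Sum>s\<in>S. c s * \<sigma> n)"
    proof (intro sum_mono mult_left_mono c)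
      fix s
      have "(\<Sum>t\<in>G - E. u (s + t)) = sum u ((+) s ` (G - E))"
        by (simp add: sum.reindex inj_on_def)
      also have "card ((+) s ` (G - E)) \<le> card G"
        by (meson G(1) Diff_subset card_image_le card_mono finite_Diff order_trans)
      then have "sum u ((+) s ` (G - E)) \<le> \<sigma> n"
        using G by (intro up) auto
      finally show "(\<Sum>t\<in>G - E. u (s + t)) \<le> \<sigma> n" .
    qed
    finally show ?thesis by (simp add: C_def sum_distrib_right)
  qed
  have "\<sigma> n \<le> W / (1 - C)" for n
  proof -
    have "\<sigma> n \<le> W + C * \<sigma> n"
      unfolding \<sigma>_def[of n] using step[of _ n] by (intro cSup_least) (auto simp: \<sigma>_def intro!: exI[of _ "{}"])
    then show ?thesis using c(2) by (simp add: C_def field_simps)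
  qed
  then have "sum u G \<le> W / (1 - C)" if "finite G" for G
    using up[OF that order_refl] order_trans by blast
  then show ?thesis
    using u by (intro nonneg_bdd_above_summable_on) (auto simp: bdd_above_def)
qed

section \<open>Hahn-Banach extension and coefficient bounds\<close>

text \<open>A linear functional dominated by \<open>p\<close> on a subspace is encoded by its graph \<open>H\<close>.\<close>

lemma dominated_graph_extend:
  fixes p :: "'v::real_vector \<Rightarrow> real"
  assumes add: "\<And>x y. p (x + y) \<le> p x + p y" and scale: "\<And>a x. a > 0 \<Longrightarrow> p (a *\<^sub>R x) = a * p x"
    and H: "subspace H" "\<And>v r. (v, r) \<in> H \<Longrightarrow> r \<le> p v"
  obtains \<gamma> where "\<And>v r. (v, r) \<in> span (insert (e, \<gamma>) H) \<Longrightarrow> r \<le> p v"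
proof -
  \<comment> \<open>The lower bounds that negative multiples of \<open>e\<close> impose on
    \<open>\<gamma>\<close>. By \<open>LU\<close> they lie below all upper bounds coming from
    positive multiples, so their supremum is admissible.\<close>
  define L where "L = {r - p (v - e) | v r. (v, r) \<in> H}"
  have LU: "r - p (v - e) \<le> p (v' + e) - r'" if "(v, r) \<in> H" "(v', r') \<in> H" for v r v' r'
  proof -
    have "r + r' \<le> p (v + v')"
      using subspace_add[OF H(1) that] by (intro H(2)) simp
    also have "\<dots> \<le> p (v - e) + p (v' + e)"
      using add[of "v - e" "v' + e"] by simp
    finally show ?thesis by simp
  qed
  have "(0, 0) \<in> H" using subspace_0[OF H(1)] by (simp add: zero_prod_def)
  then have ne: "L \<noteq> {}" and bdd: "bdd_above L"
    using LU unfolding L_def bdd_above_def by blast+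
  define \<gamma> where "\<gamma> = Sup L"
  have lo: "r - p (v - e) \<le> \<gamma>" if "(v, r) \<in> H" for v r
    unfolding \<gamma>_def using that by (intro cSup_upper bdd) (auto simp: L_def)
  have hi: "\<gamma> \<le> p (v + e) - r" if "(v, r) \<in> H" for v r
    unfolding \<gamma>_def using LU that by (intro cSup_least ne) (auto simp: L_def)
  show thesis
  proof
    fix v r assume "(v, r) \<in> span (insert (e, \<gamma>) H)"
    then obtain k where "(v, r) - k *\<^sub>R (e, \<gamma>) \<in> H"
      by (auto simp: span_insert span_eq_iff[THEN iffD2, OF H(1)])
    then have k: "(v - k *\<^sub>R e, r - k * \<gamma>) \<in> H" by simp
    consider "k = 0" | "k > 0" | "k < 0" by linarith
    then show "r \<le> p v"
    proof cases
      case 1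
      then show ?thesis using k H(2) by simp
    next
      case 2
      have "((1 / k) *\<^sub>R (v - k *\<^sub>R e), (1 / k) * (r - k * \<gamma>)) \<in> H"
        using subspace_scale[OF H(1) k, of "1 / k"] by simp
      from hi[OF this] have "r / k \<le> p ((1 / k) *\<^sub>R v)"
        using 2 by (simp add: algebra_simps diff_divide_distrib)
      also have "\<dots> = (1 / k) * p v" using 2 by (intro scale) simp
      finally show ?thesis using 2 by (simp add: field_simps)
    next
      case 3
      have "((- 1 / k) *\<^sub>R (v - k *\<^sub>R e), (- 1 / k) * (r - k * \<gamma>)) \<in> H"
        using subspace_scale[OF H(1) k, of "- 1 / k"] by simp
      from lo[OF this] have "- r / k \<le> p ((- 1 / k) *\<^sub>R v)"
        using 3 by (simp add: algebra_simps diff_divide_distrib)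
      also have "\<dots> = (- 1 / k) * p v" using 3 by (intro scale) (simp add: divide_neg_neg)
      finally show ?thesis using 3 by (simp add: field_simps)
    qed
  qed
qed

text \<open>One-step extension applied in turn. The application adjoins only the unit vectors of
  finitely many coordinates.\<close>

lemma dominated_graph_extend_finite:
  fixes p :: "'v::real_vector \<Rightarrow> real"
  assumes add: "\<And>x y. p (x + y) \<le> p x + p y" and scale: "\<And>a x. a > 0 \<Longrightarrow> p (a *\<^sub>R x) = a * p x"
    and H: "subspace H" "\<And>v r. (v, r) \<in> H \<Longrightarrow> r \<le> p v" and "finite E"
  obtains H' where "subspace H'" "H \<subseteq> H'" "\<And>v r. (v, r) \<in> H' \<Longrightarrow> r \<le> p v" "\<And>e. e \<in> E \<Longrightarrow> \<exists>\<gamma>. (e, \<gamma>) \<in> H'"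
proof -
  have "\<exists>H'. subspace H' \<and> H \<subseteq> H' \<and> (\<forall>v r. (v, r) \<in> H' \<longrightarrow> r \<le> p v) \<and> (\<forall>e\<in>E. \<exists>\<gamma>. (e, \<gamma>) \<in> H')"
    using \<open>finite E\<close>
  proof induction
    case empty
    then show ?case using H by blast
  next
    case (insert e E)
    then obtain H1 where H1: "subspace H1" "H \<subseteq> H1" "\<And>v r. (v, r) \<in> H1 \<Longrightarrow> r \<le> p v" "\<forall>e\<in>E. \<exists>\<gamma>. (e, \<gamma>) \<in> H1"
      by blast
    obtain \<gamma> where \<gamma>: "\<And>v r. (v, r) \<in> span (insert (e, \<gamma>) H1) \<Longrightarrow> r \<le> p v"
      using dominated_graph_extend[OF add scale H1(1,3)] by blast
    have "insert (e, \<gamma>) H1 \<subseteq> span (insert (e, \<gamma>) H1)" by (rule span_superset)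
    then show ?case
      using \<gamma> H1(2,4) by (intro exI[of _ "span (insert (e, \<gamma>) H1)"]) (blast intro: subspace_span)
  qed
  then show thesis using that by blast
qed

lemma lookup_scaleR_real: "Poly_Mapping.lookup (r *\<^sub>R v) i = r * Poly_Mapping.lookup v i"
  for v :: "('i, real) poly_mapping"
proof -
  have "finite {i. r *\<^sub>R Poly_Mapping.lookup v i \<noteq> 0}"
    by (rule finite_subset[OF _ finite_lookup[of v]]) auto
  then show ?thesis by (simp add: scaleR_poly_mapping_def)
qed

text \<open>Hahn-Banach for \<open>d\<close> times the maximum norm over \<open>I\<close>:
  \<open>c i\<close> is the value of the extended functional at the unit vector of \<open>i\<close>,
  and testing it on the vector of signs of \<open>c\<close> gives the bound on the absolute sum. The
  type \<open>poly_mapping\<close> serves as a real vector space with coordinates indexed by an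
  arbitrary type.\<close>

lemma dominated_coordinate:
  fixes W :: "('i, real) poly_mapping set"
  assumes "finite I" "I \<noteq> {}" "d \<ge> 0" and W: "subspace W"
    and dom: "\<And>w. w \<in> W \<Longrightarrow> Poly_Mapping.lookup w j \<le> d * Max ((\<lambda>i. \<bar>Poly_Mapping.lookup w i\<bar>) ` I)"
  obtains c where "(\<Sum>i\<in>I. \<bar>c i\<bar>) \<le> d"
    "\<And>w. w \<in> W \<Longrightarrow> Poly_Mapping.lookup w j = (\<Sum>i\<in>I. Poly_Mapping.lookup w i * c i)"
proof -
  let ?l = "Poly_Mapping.lookup"
  define M where "M w = Max ((\<lambda>i. \<bar>?l w i\<bar>) ` I)" for w :: "('i, real) poly_mapping"
  define p where "p w = d * M w" for w
  have M_le: "M w \<le> r \<longleftrightarrow> (\<forall>i\<in>I. \<bar>?l w i\<bar> \<le> r)" for w r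
    unfolding M_def using assms(1,2) by (subst Max_le_iff) auto
  have M_ge: "\<bar>?l w i\<bar> \<le> M w" if "i \<in> I" for w i
    using M_le[of w "M w"] that by simp
  have "M (x + y) \<le> M x + M y" for x y
    unfolding M_le by (auto simp: lookup_add intro!: order_trans[OF abs_triangle_ineq] add_mono M_ge)
  then have p_add: "p (x + y) \<le> p x + p y" for x y
    unfolding p_def using \<open>d \<ge> 0\<close> by (metis mult_left_mono distrib_left)
  have le: "M (a *\<^sub>R x) \<le> a * M x" if "a > 0" for a x
    unfolding M_le using that M_ge by (auto simp: lookup_scaleR_real abs_mult)
  have "M (a *\<^sub>R x) = a * M x" if "a > 0" for a x
    using le[OF that, of x] le[of "1 / a" "a *\<^sub>R x"] that by (simp add: field_simps)
  then have p_scale: "p (a *\<^sub>R x) = a * p x" if "a > 0" for a x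
    using that by (simp add: p_def)
  define H where "H = (\<lambda>w. (w, ?l w j)) ` W"
  have "linear (\<lambda>w :: ('i, real) poly_mapping. (w, ?l w j))"
    by (intro linearI) (simp_all add: lookup_add lookup_scaleR_real)
  then have "subspace H"
    unfolding H_def using W by (intro linear_subspace_image)
  moreover have "r \<le> p v" if "(v, r) \<in> H" for v r
    using that dom by (auto simp: H_def p_def M_def)
  ultimately obtain H' where H': "subspace H'" "H \<subseteq> H'" "\<And>v r. (v, r) \<in> H' \<Longrightarrow> r \<le> p v"
    "\<And>e. e \<in> (\<lambda>i. Poly_Mapping.single i 1) ` I \<Longrightarrow> \<exists>\<gamma>. (e, \<gamma>) \<in> H'"
    using dominated_graph_extend_finite[OF p_add p_scale, of H "(\<lambda>i. Poly_Mapping.single i 1) ` I"] assms(1)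
    by blast
  have "\<forall>i\<in>I. \<exists>\<gamma>. (Poly_Mapping.single i 1, \<gamma>) \<in> H'"
    using H'(4) by auto
  then obtain c where c: "\<And>i. i \<in> I \<Longrightarrow> (Poly_Mapping.single i 1, c i) \<in> H'"
    using bchoice[of I "\<lambda>i \<gamma>. (Poly_Mapping.single i 1, \<gamma>) \<in> H'"] by blast
  have comb: "((\<Sum>i\<in>I. b i *\<^sub>R Poly_Mapping.single i 1), (\<Sum>i\<in>I. b i * c i)) \<in> H'" for b
  proof -
    have "(\<Sum>i\<in>I. b i *\<^sub>R (Poly_Mapping.single i 1, c i)) \<in> H'"
      by (intro subspace_sum[OF H'(1)] subspace_scale[OF H'(1)] c)
    then show ?thesis by (simp add: sum_prod)
  qed
  have lk: "?l (\<Sum>i\<in>I. b i *\<^sub>R Poly_Mapping.single i 1) k = b k" if "k \<in> I" for b :: "'i \<Rightarrow> real" and k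
  proof -
    have "?l (\<Sum>i\<in>I. b i *\<^sub>R Poly_Mapping.single i 1) k = (\<Sum>i\<in>I. if i = k then b i else 0)"
      unfolding lookup_sum by (intro sum.cong) (auto simp: lookup_scaleR_real lookup_single when_def)
    then show ?thesis using that assms(1) by simp
  qed
  show thesis
  proof
    have "M (\<Sum>i\<in>I. sgn (c i) *\<^sub>R Poly_Mapping.single i 1) \<le> 1"
      unfolding M_le by (auto simp: lk sgn_if)
    then have "p (\<Sum>i\<in>I. sgn (c i) *\<^sub>R Poly_Mapping.single i 1) \<le> d"
      using \<open>d \<ge> 0\<close> mult_left_mono[of _ 1 d] unfolding p_def by auto
    from order_trans[OF H'(3)[OF comb[of "\<lambda>i. sgn (c i)"]] this]
    show "(\<Sum>i\<in>I. \<bar>c i\<bar>) \<le> d" by (simp add: abs_sgn mult.commute)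
  next
    fix w assume "w \<in> W"
    then have wH: "(w, ?l w j) \<in> H'" using H'(2) by (auto simp: H_def)
    \<comment> \<open>\<open>v\<close> vanishes on \<open>I\<close> but perhaps not outside. Still
      \<open>p\<close> is at most 0 at both \<open>v\<close> and \<open>- v\<close>, and domination
      forces the value \<open>r\<close> to be 0.\<close>
    define v where "v = w - (\<Sum>i\<in>I. ?l w i *\<^sub>R Poly_Mapping.single i 1)"
    define r where "r = ?l w j - (\<Sum>i\<in>I. ?l w i * c i)"
    have d: "(v, r) \<in> H'"
      using subspace_diff[OF H'(1) wH comb[of "?l w"]] by (simp add: v_def r_def)
    have nd: "(- v, - r) \<in> H'"
      using subspace_neg[OF H'(1) d] by simp
    have "?l v i = 0" if "i \<in> I" for i
      using lk[OF that, of "?l w"] by (simp add: v_def lookup_minus)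
    then have "M v \<le> 0" "M (- v) \<le> 0"
      unfolding M_le by simp_all
    then have "p v \<le> 0" "p (- v) \<le> 0"
      using \<open>d \<ge> 0\<close> by (simp_all add: p_def mult_nonneg_nonpos)
    with H'(3)[OF d] H'(3)[OF nd] show "?l w j = (\<Sum>i\<in>I. ?l w i * c i)"
      by (simp add: r_def)
  qed
qed

section \<open>Angles of character values and their linearization\<close>

lemma pontryagin_dual_simps:
  assumes "\<phi> \<in> pontryagin_dual"
  shows "cmod (\<phi> x) = 1" "\<phi> (x + y) = \<phi> x * \<phi> y" "\<phi> 0 = 1" "\<phi> (- x) = cnj (\<phi> x)"
proof -
  show n: "cmod (\<phi> x) = 1" and m: "\<phi> (x + y) = \<phi> x * \<phi> y" for x y
    using assms by (auto simp: pontryagin_dual_def)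
  have "\<phi> 0 * \<phi> 0 = \<phi> 0" using m[of 0 0] by simp
  moreover have "\<phi> 0 \<noteq> 0" using n[of 0] by auto
  ultimately show 0: "\<phi> 0 = 1" by simp
  have "\<phi> x * \<phi> (- x) = 1" using m[of x "- x"] 0 by simp
  moreover have "\<phi> x * cnj (\<phi> x) = 1" using n[of x] by (simp add: complex_norm_square[symmetric])
  moreover have "\<phi> x \<noteq> 0" using n[of x] by auto
  ultimately show "\<phi> (- x) = cnj (\<phi> x)" by (metis mult_left_cancel)
qed

lemma cis_Arg_unit: "cmod z = 1 \<Longrightarrow> cis (Arg z) = z"
  by (subst cis_Arg) (auto simp: sgn_div_norm)

text \<open>Chord against arc: the modulus of \<open>cis t - 1\<close> is twice that of
  \<open>sin (t / 2)\<close>.\<close>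

lemma cmod_minus_one_le_Arg: "cmod z = 1 \<Longrightarrow> cmod (z - 1) \<le> \<bar>Arg z\<bar>"
proof -
  assume "cmod z = 1"
  have "(cmod (cis t - 1))\<^sup>2 \<le> t\<^sup>2" for t :: real
  proof -
    have "(cmod (cis t - 1))\<^sup>2 = 2 - 2 * cos t"
      unfolding cmod_power2 by (simp add: power2_diff algebra_simps)
    also have "\<dots> = 4 * (sin (t / 2))\<^sup>2"
      using cos_double_sin[of "t / 2"] by simp
    also have "\<dots> \<le> 4 * (\<bar>t / 2\<bar>)\<^sup>2"
      using power_mono[OF abs_sin_x_le_abs_x[of "t / 2"], of 2] by simp
    finally show ?thesis by (simp add: power_divide)
  qed
  from this[of "Arg z"] show ?thesis
    using \<open>cmod z = 1\<close> by (simp add: cis_Arg_unit abs_le_square_iff[symmetric])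
qed

lemma Arg_small:
  assumes "r > 0"
  obtains d where "d > 0" "\<And>z. cmod (z - 1) < d \<Longrightarrow> \<bar>Arg z\<bar> < r"
proof -
  have "isCont Arg 1" by (rule continuous_at_Arg) (simp add: complex_nonpos_Reals_iff)
  then show thesis
    using that assms unfolding continuous_at_eps_delta by (auto simp: dist_norm)
qed

text \<open>Integer combinations of lifted points lift points of the group again; rounding the
  coefficients of a real combination therefore transfers the bound \<open>dom\<close> to the linear span of the
  small lifts.\<close>

lemma Arg_linearization:
  fixes \<psi> :: "'i \<Rightarrow> 'x::ab_group_add \<Rightarrow> complex"
  assumes I: "finite I" "j \<in> I"
    and unit: "\<And>i x. i \<in> I \<Longrightarrow> cmod (\<psi> i x) = 1"
    and mult: "\<And>i x y. i \<in> I \<Longrightarrow> \<psi> i (x + y) = \<psi> i x * \<psi> i y"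
    and e: "0 < e" "e < pi" and d: "0 < d" "d \<le> 1"
    and dom: "\<And>y. (\<And>i. i \<in> I \<Longrightarrow> \<bar>Arg (\<psi> i y)\<bar> \<le> e) \<Longrightarrow> \<bar>Arg (\<psi> j y)\<bar> \<le> d * e / 4"
  obtains c where "(\<Sum>i\<in>I. \<bar>c i\<bar>) \<le> d"
    "\<And>x. \<forall>i\<in>I. \<bar>Arg (\<psi> i x)\<bar> \<le> d * e / (4 * card I) \<Longrightarrow> Arg (\<psi> j x) = (\<Sum>i\<in>I. c i * Arg (\<psi> i x))"
proof -
  let ?l = "Poly_Mapping.lookup :: ('i, real) poly_mapping \<Rightarrow> 'i \<Rightarrow> real"
  \<comment> \<open>Small enough that a rounding error of at most 1 in each of at most
    \<open>card I\<close> coefficients changes every coordinate by at most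
    \<open>d * e / 4\<close>.\<close>
  define \<rho> where "\<rho> = d * e / (4 * card I)"
  have "card I > 0" using I by (auto simp: card_gt_0_iff)
  then have "\<rho> > 0" using d e by (simp add: \<rho>_def)
  define vec :: "'x \<Rightarrow> ('i, real) poly_mapping"
    where "vec x = (\<Sum>i\<in>I. Arg (\<psi> i x) *\<^sub>R Poly_Mapping.single i 1)" for x
  have lvec: "?l (vec x) i = Arg (\<psi> i x)" if "i \<in> I" for x i
  proof -
    have "?l (vec x) i = (\<Sum>k\<in>I. if k = i then Arg (\<psi> k x) else 0)"
      unfolding vec_def lookup_sum
      by (intro sum.cong) (auto simp: lookup_scaleR_real lookup_single when_def)
    then show ?thesis using that I(1) by simp
  qed
  define S where "S = vec ` {x. \<forall>i\<in>I. \<bar>Arg (\<psi> i x)\<bar> \<le> \<rho>}"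
  \<comment> \<open>The basis consists of lifts of actual group elements, so its integer
    combinations again come from group elements.\<close>
  obtain B where B: "B \<subseteq> S" "independent B" "S \<subseteq> span B"
    using maximal_independent_subset by blast
  have "vec x \<in> span ((\<lambda>i. Poly_Mapping.single i 1) ` I)" for x
    unfolding vec_def by (intro span_sum span_scale span_base) auto
  then have "B \<subseteq> span ((\<lambda>i. Poly_Mapping.single i 1) ` I)"
    using B(1) by (auto simp: S_def)
  from independent_span_bound[OF _ B(2) this] have fB: "finite B" and "card B \<le> card I"
    using I(1) card_image_le[OF I(1)] order_trans by blast+
  \<comment> \<open>The vectors that represent the angles of some group element modulo full turns: a
    subgroup, unlike the set of principal angles.\<close>
  define \<Lambda> where "\<Lambda> = {w. \<exists>y. \<forall>i\<in>I. \<psi> i y = cis (?l w i)}"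
  have \<Lambda>_add: "w + w' \<in> \<Lambda>" if "w \<in> \<Lambda>" "w' \<in> \<Lambda>" for w w'
  proof -
    obtain y y' where "\<forall>i\<in>I. \<psi> i y = cis (?l w i)" "\<forall>i\<in>I. \<psi> i y' = cis (?l w' i)"
      using \<open>w \<in> \<Lambda>\<close> \<open>w' \<in> \<Lambda>\<close> by (auto simp: \<Lambda>_def)
    then have "\<forall>i\<in>I. \<psi> i (y + y') = cis (?l (w + w') i)"
      by (simp add: mult lookup_add cis_mult)
    then show ?thesis unfolding \<Lambda>_def by blast
  qed
  have \<psi>0: "\<psi> i 0 = 1" if "i \<in> I" for i
  proof -
    have "\<psi> i 0 * \<psi> i 0 = \<psi> i 0" using mult[OF that, of 0 0] by simp
    moreover have "\<psi> i 0 \<noteq> 0" using unit[OF that, of 0] by auto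
    ultimately show ?thesis by simp
  qed
  have \<Lambda>_0: "0 \<in> \<Lambda>"
    unfolding \<Lambda>_def using \<psi>0 by (intro CollectI exI[of _ 0]) simp
  have \<Lambda>_minus: "- w \<in> \<Lambda>" if "w \<in> \<Lambda>" for w
  proof -
    obtain y where y: "\<forall>i\<in>I. \<psi> i y = cis (?l w i)"
      using \<open>w \<in> \<Lambda>\<close> by (auto simp: \<Lambda>_def)
    have "\<psi> i (- y) = cis (?l (- w) i)" if "i \<in> I" for i
    proof -
      have "\<psi> i y * \<psi> i (- y) = 1" using mult[OF that, of y "- y"] \<psi>0[OF that] by simp
      then have "cis (?l w i) * \<psi> i (- y) = cis (?l w i) * cis (- ?l w i)" using y that by (simp add: cis_mult)
      then show ?thesis by (simp add: lookup_uminus)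
    qed
    then show ?thesis unfolding \<Lambda>_def by blast
  qed
  have \<Lambda>_nat: "real n *\<^sub>R w \<in> \<Lambda>" if "w \<in> \<Lambda>" for n w
    by (induction n) (use that in \<open>simp_all add: \<Lambda>_0 \<Lambda>_add scaleR_add_left\<close>)
  have \<Lambda>_int: "real_of_int n *\<^sub>R w \<in> \<Lambda>" if "w \<in> \<Lambda>" for n w
    by (cases n rule: int_cases2) (use \<Lambda>_nat[OF that] \<Lambda>_minus in auto)
  have \<Lambda>_vec: "vec x \<in> \<Lambda>" for x
    unfolding \<Lambda>_def by (intro CollectI exI[of _ x]) (simp add: lvec cis_Arg_unit unit)
  \<comment> \<open>Rounding costs at most \<open>d * e / 4 \<le> e / 4\<close>, so coordinates up
    to \<open>e / 2\<close> stay below \<open>e\<close>. On coordinate \<open>j\<close> the bound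
    \<open>d * e / 4\<close> from \<open>dom\<close> and the same rounding error add up to
    \<open>d * e / 2\<close>.\<close>
  have small: "\<bar>?l w j\<bar> \<le> d * e / 2" if w: "w \<in> span B" and le: "\<And>i. i \<in> I \<Longrightarrow> \<bar>?l w i\<bar> \<le> e / 2" for w
  proof -
    obtain u where u: "w = (\<Sum>b\<in>B. u b *\<^sub>R b)"
      using w unfolding span_finite[OF fB] by auto
    define w' where "w' = (\<Sum>b\<in>B. real_of_int \<lfloor>u b\<rfloor> *\<^sub>R b)"
    have "(\<Sum>b\<in>B'. real_of_int \<lfloor>u b\<rfloor> *\<^sub>R b) \<in> \<Lambda>" if "B' \<subseteq> B" for B'
      using finite_subset[OF that fB] that
      by (induction B') (use \<Lambda>_0 \<Lambda>_add \<Lambda>_int \<Lambda>_vec B(1) in \<open>auto simp: S_def\<close>)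
    then have "w' \<in> \<Lambda>" by (simp add: w'_def)
    then obtain y where y: "\<And>i. i \<in> I \<Longrightarrow> \<psi> i y = cis (?l w' i)" by (auto simp: \<Lambda>_def)
    have diff: "\<bar>?l w i - ?l w' i\<bar> \<le> d * e / 4" if i: "i \<in> I" for i
    proof -
      have "\<bar>?l w i - ?l w' i\<bar> = \<bar>\<Sum>b\<in>B. frac (u b) * ?l b i\<bar>"
        by (simp add: u w'_def lookup_sum lookup_scaleR_real sum_subtractf[symmetric] frac_def left_diff_distrib)
      also have "\<dots> \<le> (\<Sum>b\<in>B. \<bar>frac (u b) * ?l b i\<bar>)" by (rule sum_abs)
      also have "\<dots> \<le> (\<Sum>b\<in>B. 1 * \<rho>)"
      proof (rule sum_mono)
        fix b assume "b \<in> B"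
        then have "\<bar>?l b i\<bar> \<le> \<rho>" using B(1) i by (auto simp: S_def lvec)
        then show "\<bar>frac (u b) * ?l b i\<bar> \<le> 1 * \<rho>"
          unfolding abs_mult by (intro mult_mono) (auto simp: frac_ge_0 less_imp_le[OF frac_lt_1])
      qed
      also have "\<dots> \<le> card I * \<rho>" using \<open>card B \<le> card I\<close> \<open>\<rho> > 0\<close> by simp
      also have "\<dots> = d * e / 4" using \<open>card I > 0\<close> by (simp add: \<rho>_def)
      finally show ?thesis .
    qed
    have de: "d * e \<le> e" using d e by simp
    have w'e: "\<bar>?l w' i\<bar> \<le> e" if "i \<in> I" for i
      using diff[OF that] le[OF that] de e by linarith
    \<comment> \<open>As \<open>e < pi\<close>, the rounded coordinates are the principal arguments
      themselves and not merely congruent to them, so \<open>dom\<close> applies to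
      \<open>y\<close>.\<close>
    have A: "Arg (\<psi> i y) = ?l w' i" if "i \<in> I" for i
    proof -
      have "?l w' i \<in> {- pi<..pi}" using w'e[OF that] e by auto
      then show ?thesis using y[OF that] by (simp add: Arg_cis)
    qed
    have "\<bar>?l w' j\<bar> \<le> d * e / 4"
      using dom[of y] A w'e I(2) by simp
    then show ?thesis using diff[OF I(2)] by linarith
  qed
  have bound: "?l w j \<le> d * Max ((\<lambda>i. \<bar>?l w i\<bar>) ` I)" if w: "w \<in> span B" for w
  proof -
    define M where "M = Max ((\<lambda>i. \<bar>?l w i\<bar>) ` I)"
    have M: "\<bar>?l w i\<bar> \<le> M" if "i \<in> I" for i
      unfolding M_def using that I(1) by simp
    have "M \<ge> 0" using M[OF I(2)] by linarith
    show ?thesis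
    proof (cases "M = 0")
      case True
      then show ?thesis using M[OF I(2)] by (simp add: M_def[symmetric])
    next
      case False
      with \<open>M \<ge> 0\<close> have "M > 0" by simp
      \<comment> \<open>Scales \<open>w\<close> to maximum norm \<open>e / 2\<close>, the range of
        \<open>small\<close>.\<close>
      define t where "t = e / (2 * M)"
      have "t > 0" using e \<open>M > 0\<close> by (simp add: t_def)
      have "\<bar>?l (t *\<^sub>R w) j\<bar> \<le> d * e / 2"
      proof (rule small)
        show "t *\<^sub>R w \<in> span B" by (rule span_scale[OF w])
        fix i assume "i \<in> I"
        have "\<bar>?l (t *\<^sub>R w) i\<bar> = t * \<bar>?l w i\<bar>" using \<open>t > 0\<close> by (simp add: lookup_scaleR_real abs_mult)
        also have "\<dots> \<le> t * M" using M[OF \<open>i \<in> I\<close>] \<open>t > 0\<close> by simp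
        also have "\<dots> = e / 2" using \<open>M > 0\<close> by (simp add: t_def)
        finally show "\<bar>?l (t *\<^sub>R w) i\<bar> \<le> e / 2" .
      qed
      moreover have "d * e / 2 = t * (d * M)"
        using \<open>M > 0\<close> by (simp add: t_def)
      ultimately have "t * \<bar>?l w j\<bar> \<le> t * (d * M)"
        using \<open>t > 0\<close> by (simp add: lookup_scaleR_real abs_mult)
      then have "\<bar>?l w j\<bar> \<le> d * M" using \<open>t > 0\<close> by simp
      then show ?thesis by (simp add: M_def[symmetric])
    qed
  qed
  obtain c where c: "(\<Sum>i\<in>I. \<bar>c i\<bar>) \<le> d" "\<And>w. w \<in> span B \<Longrightarrow> ?l w j = (\<Sum>i\<in>I. ?l w i * c i)"
    using dominated_coordinate[OF I(1) _ _ subspace_span bound] I(2) d by (metis empty_iff less_imp_le)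
  show thesis
  proof (rule that[OF c(1)])
    fix x assume "\<forall>i\<in>I. \<bar>Arg (\<psi> i x)\<bar> \<le> d * e / (4 * card I)"
    then have "vec x \<in> span B" using B(3) by (auto simp: S_def \<rho>_def)
    from c(2)[OF this] show "Arg (\<psi> j x) = (\<Sum>i\<in>I. c i * Arg (\<psi> i x))"
      using I(2) by (simp add: lvec mult.commute cong: sum.cong)
  qed
qed

section \<open>Homoclinic points\<close>

text \<open>Each \<open>y\<close> outside \<open>V\<close> has a character that stays away from 1
  near \<open>y\<close>; compactness of the complement leaves finitely many.\<close>

lemma finite_Bohr_subset:
  fixes V :: "'x::topological_ab_group_add set"
  assumes cpt: "compact (UNIV :: 'x set)" and V: "open V" "0 \<in> V"
    and sep: "\<And>a::'x. a \<noteq> 0 \<Longrightarrow> \<exists>\<phi>\<in>pontryagin_dual. \<phi> a \<noteq> 1"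
  obtains \<Phi> e where "finite \<Phi>" "\<Phi> \<subseteq> pontryagin_dual" "e > 0"
    "\<And>x. (\<And>\<phi>. \<phi> \<in> \<Phi> \<Longrightarrow> cmod (\<phi> x - 1) < e) \<Longrightarrow> x \<in> V"
proof -
  have "\<forall>y\<in>- V. \<exists>\<phi>. \<phi> \<in> pontryagin_dual \<and> \<phi> y \<noteq> 1"
    using sep V(2) by (metis ComplD)
  then obtain \<zeta> :: "'x \<Rightarrow> 'x \<Rightarrow> complex" where c: "\<And>y. y \<in> - V \<Longrightarrow> \<zeta> y \<in> pontryagin_dual" "\<And>y. y \<in> - V \<Longrightarrow> \<zeta> y y \<noteq> 1"
    using bchoice[of "- V" "\<lambda>y \<phi>. \<phi> \<in> pontryagin_dual \<and> \<phi> y \<noteq> 1"] by blast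
  define O' where "O' y = {x. cmod (\<zeta> y y - 1) / 2 < cmod (\<zeta> y x - 1)}" for y
  have "compact (- V)" using compact_Int_closed[OF cpt closed_Compl[OF V(1)]] by simp
  moreover have "open (O' y)" if "y \<in> - V" for y
    unfolding O'_def using c(1)[OF that]
    by (intro open_Collect_less continuous_intros) (auto simp: pontryagin_dual_def)
  moreover have "- V \<subseteq> (\<Union>y\<in>- V. O' y)"
    using c(2) by (force simp: O'_def)
  ultimately obtain T where T: "T \<subseteq> - V" "finite T" "- V \<subseteq> (\<Union>y\<in>T. O' y)"
    by (rule compactE_image)
  \<comment> \<open>The inserted 1 keeps \<open>Min\<close> meaningful when \<open>T\<close> is
    empty, that is, possibly when \<open>V\<close> is the whole group.\<close>
  define e where "e = Min (insert 1 ((\<lambda>y. cmod (\<zeta> y y - 1) / 2) ` T))"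
  show thesis
  proof
    show "finite (\<zeta> ` T)" "\<zeta> ` T \<subseteq> pontryagin_dual" using T c(1) by auto
    show "e > 0" unfolding e_def using T(1,2) c(2) by (subst Min_gr_iff) auto
    fix x assume x: "\<And>\<phi>. \<phi> \<in> \<zeta> ` T \<Longrightarrow> cmod (\<phi> x - 1) < e"
    show "x \<in> V"
    proof (rule ccontr)
      assume "x \<notin> V"
      then obtain y where y: "y \<in> T" "cmod (\<zeta> y y - 1) / 2 < cmod (\<zeta> y x - 1)"
        using T(3) by (auto simp: O'_def)
      have "e \<le> cmod (\<zeta> y y - 1) / 2" unfolding e_def using T(2) y(1) by (intro Min_le) auto
      then show False using x[of "\<zeta> y"] y by auto
    qed
  qed
qed

lemma compatible_metric_continuous:
  fixes \<rho> :: "'x::topological_space \<Rightarrow> 'x \<Rightarrow> real"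
  assumes "compatible_metric \<rho>"
  shows "continuous_on UNIV (\<lambda>x. \<rho> x a)"
proof -
  interpret Metric_space UNIV \<rho> using assms by (simp add: compatible_metric_def)
  have top: "mtopology = euclidean" using assms by (simp add: compatible_metric_def)
  have "((\<lambda>x. \<rho> x a) \<longlongrightarrow> \<rho> y a) (at y)" for y
  proof (rule tendstoI)
    fix e :: real assume "e > 0"
    have "open (mball y e)" using openin_mball[of y e] unfolding top by simp
    moreover have "y \<in> mball y e" using \<open>e > 0\<close> by simp
    ultimately have "\<forall>\<^sub>F x in at y. x \<in> mball y e" by (rule eventually_at_in_open')
    then show "\<forall>\<^sub>F x in at y. dist (\<rho> x a) (\<rho> y a) < e"
    proof eventually_elim
      case (elim x)
      then have "\<rho> y x < e" by simp
      then show ?case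
        using triangle[of x y a] triangle[of y x a] commute[of x y] by (simp add: dist_real_def)
    qed
  qed
  then show ?thesis by (simp add: continuous_on_def)
qed

lemma compatible_metric_zero_iff: "compatible_metric \<rho> \<Longrightarrow> \<rho> x y = 0 \<longleftrightarrow> x = y"
  unfolding compatible_metric_def by (auto simp: Metric_space.zero)

lemma acts_simps:
  assumes "acts_by_automorphisms \<alpha>"
  shows "\<alpha> 0 x = x" "\<alpha> (s + t) x = \<alpha> s (\<alpha> t x)" "\<alpha> s (x + y) = \<alpha> s x + \<alpha> s y" "\<alpha> s 0 = 0"
    "continuous_on UNIV (\<alpha> s)"
proof -
  show add: "\<alpha> s (x + y) = \<alpha> s x + \<alpha> s y" for x y
    using assms by (simp add: acts_by_automorphisms_def)
  show "\<alpha> s 0 = 0" using add[of 0 0] by simp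
qed (use assms in \<open>simp_all add: acts_by_automorphisms_def\<close>)

text \<open>Expansiveness is applied to the pair of \<open>x\<close> and 0, and 0 is fixed by the
  action; the open ball of radius \<open>c\<close> then does it.\<close>

lemma expansive_neighbourhood:
  fixes \<alpha> :: "'g::group_add \<Rightarrow> 'x::topological_ab_group_add \<Rightarrow> 'x"
  assumes act: "acts_by_automorphisms \<alpha>" and exp: "expansive \<alpha>"
  obtains V where "open V" "0 \<in> V" "\<And>x. (\<And>s. \<alpha> s x \<in> V) \<Longrightarrow> x = 0"
proof -
  obtain \<rho> c where \<rho>: "compatible_metric \<rho>" "c > 0"
    "\<And>x y. x \<noteq> y \<Longrightarrow> (SUP s. \<rho> (\<alpha> s x) (\<alpha> s y)) > c"
    using exp unfolding expansive_def by blast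
  show thesis
  proof
    show "open {x. \<rho> x 0 < c}"
      using compatible_metric_continuous[OF \<rho>(1)] by (intro open_Collect_less continuous_intros)
    show "0 \<in> {x. \<rho> x 0 < c}"
      using \<rho>(2) compatible_metric_zero_iff[OF \<rho>(1)] by (metis mem_Collect_eq)
    fix x assume "\<And>s. \<alpha> s x \<in> {x. \<rho> x 0 < c}"
    then have "(SUP s. \<rho> (\<alpha> s x) (\<alpha> s 0)) \<le> c"
      by (intro cSUP_least) (auto simp: acts_simps[OF act] less_imp_le)
    then show "x = 0" using \<rho>(3)[of x 0] by linarith
  qed
qed

lemma summable_on_eventually_less:
  fixes f :: "'a \<Rightarrow> real"
  assumes "f summable_on UNIV" "\<And>x. f x \<ge> 0" "e > 0"
  shows "\<forall>\<^sub>F x in cofinite. f x < e"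
proof -
  have "finite {x. \<not> f x < e}"
  proof (rule ccontr)
    assume inf: "infinite {x. \<not> f x < e}"
    obtain n :: nat where n: "infsum f UNIV < n * e"
      using reals_Archimedean3[OF \<open>e > 0\<close>] by blast
    obtain T where T: "T \<subseteq> {x. \<not> f x < e}" "finite T" "card T = n"
      using infinite_arbitrarily_large[OF inf] by blast
    have "n * e \<le> sum f T" using sum_bounded_below[of T e f] T by (auto simp: not_less)
    also have "\<dots> \<le> infsum f UNIV" using assms T by (intro finite_sum_le_infsum) auto
    finally show False using n by simp
  qed
  then show ?thesis by (simp add: eventually_cofinite)
qed

section \<open>The two inclusions\<close>

text \<open>Summable terms tend to 0, so each character tends to 1 along the orbit, and finitely
  many characters control a given neighbourhood of 0.\<close>

lemma homoclinic_points_supset: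
  fixes \<alpha> :: "'g::group_add \<Rightarrow> 'x::topological_ab_group_add \<Rightarrow> 'x"
  assumes cpt: "compact (UNIV :: 'x set)"
    and sep: "\<And>a::'x. a \<noteq> 0 \<Longrightarrow> \<exists>\<phi>\<in>pontryagin_dual. \<phi> a \<noteq> 1"
  shows "one_homoclinic_points \<alpha> \<subseteq> homoclinic_points \<alpha>"
proof
  fix x assume x: "x \<in> one_homoclinic_points \<alpha>"
  have "((\<lambda>s. \<alpha> s x) \<longlongrightarrow> 0) cofinite"
  proof (rule topological_tendstoI)
    fix V :: "'x set" assume V: "open V" "0 \<in> V"
    obtain \<Phi> e where \<Phi>: "finite \<Phi>" "\<Phi> \<subseteq> pontryagin_dual" "e > 0"
      "\<And>x. (\<And>\<phi>. \<phi> \<in> \<Phi> \<Longrightarrow> cmod (\<phi> x - 1) < e) \<Longrightarrow> x \<in> V"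
      using finite_Bohr_subset[OF cpt V sep] by blast
    have "\<forall>\<^sub>F s in cofinite. cmod (\<phi> (\<alpha> s x) - 1) < e" if "\<phi> \<in> \<Phi>" for \<phi>
    proof -
      have "(\<lambda>s. cmod (\<phi> (\<alpha> s x) - 1)) summable_on UNIV"
        using x that \<Phi>(2) by (auto simp: one_homoclinic_points_def Psi_def)
      then show ?thesis using \<Phi>(3) by (intro summable_on_eventually_less) auto
    qed
    then have "\<forall>\<^sub>F s in cofinite. \<forall>\<phi>\<in>\<Phi>. cmod (\<phi> (\<alpha> s x) - 1) < e"
      using \<Phi>(1) by (simp add: eventually_ball_finite_distrib)
    then show "\<forall>\<^sub>F s in cofinite. \<alpha> s x \<in> V"
      by eventually_elim (use \<Phi>(4) in blast)
  qed
  then show "x \<in> homoclinic_points \<alpha>" by (simp add: homoclinic_points_def)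
qed

text \<open>Every point outside \<open>U\<close> violates the bound \<open>e\<close> for some pair
  of a group element and a character, and this is an open condition. Compactness leaves finitely
  many pairs, whose group elements form \<open>F\<close>.\<close>

lemma expansive_finite_window:
  fixes \<alpha> :: "'g::group_add \<Rightarrow> 'x::topological_ab_group_add \<Rightarrow> 'x"
  assumes cpt: "compact (UNIV :: 'x set)" and act: "acts_by_automorphisms \<alpha>"
    and U: "open U" "0 \<in> U" and \<Phi>: "\<Phi> \<subseteq> pontryagin_dual"
    and exp: "\<And>x. (\<And>s \<phi>. \<phi> \<in> \<Phi> \<Longrightarrow> cmod (\<phi> (\<alpha> s x) - 1) \<le> e) \<Longrightarrow> x = 0"
  obtains F where "finite F" "\<And>x. \<forall>s\<in>F. \<forall>\<phi>\<in>\<Phi>. cmod (\<phi> (\<alpha> s x) - 1) \<le> e \<Longrightarrow> x \<in> U"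
proof -
  define O' where "O' p = {x. e < cmod (snd p (\<alpha> (fst p) x) - 1)}" for p :: "'g \<times> ('x \<Rightarrow> complex)"
  have "compact (- U)" using compact_Int_closed[OF cpt closed_Compl[OF U(1)]] by simp
  moreover have "open (O' p)" if p: "p \<in> UNIV \<times> \<Phi>" for p
  proof -
    have "continuous_on UNIV (snd p)" using p \<Phi> by (auto simp: pontryagin_dual_def)
    then have "continuous_on UNIV (\<lambda>x. snd p (\<alpha> (fst p) x))"
      by (rule continuous_on_compose2[OF _ acts_simps(5)[OF act]]) simp
    then show ?thesis
      unfolding O'_def by (intro open_Collect_less continuous_intros)
  qed
  moreover have "- U \<subseteq> (\<Union>p\<in>UNIV \<times> \<Phi>. O' p)"
  proof
    fix y assume "y \<in> - U"
    then have "y \<noteq> 0" using U(2) by auto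
    then obtain s \<phi> where "\<phi> \<in> \<Phi>" "\<not> cmod (\<phi> (\<alpha> s y) - 1) \<le> e" using exp by blast
    then show "y \<in> (\<Union>p\<in>UNIV \<times> \<Phi>. O' p)" by (auto simp: O'_def not_le intro!: bexI[of _ \<phi>])
  qed
  ultimately obtain T where T: "T \<subseteq> UNIV \<times> \<Phi>" "finite T" "- U \<subseteq> (\<Union>p\<in>T. O' p)"
    by (rule compactE_image)
  show thesis
  proof
    show "finite (fst ` T)" using T(2) by simp
    fix x assume x: "\<forall>s\<in>fst ` T. \<forall>\<phi>\<in>\<Phi>. cmod (\<phi> (\<alpha> s x) - 1) \<le> e"
    show "x \<in> U"
    proof (rule ccontr)
      assume "x \<notin> U"
      then obtain p where "p \<in> T" "e < cmod (snd p (\<alpha> (fst p) x) - 1)"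
        using T(3) by (auto simp: O'_def)
      then show False using x[rule_format, of "fst p" "snd p"] T(1) by force
    qed
  qed
qed

lemma filterlim_add_left_cofinite:
  fixes s :: "'g::group_add"
  shows "filterlim (\<lambda>t. s + t) cofinite cofinite"
  unfolding filterlim_iff eventually_cofinite
proof (intro allI impI)
  fix P :: "'g \<Rightarrow> bool" assume "finite {t. \<not> P t}"
  then have "finite ((+) s -` {t. \<not> P t})"
    by (rule finite_vimageI) simp
  then show "finite {t. \<not> P (s + t)}" by (simp add: vimage_def)
qed

lemma homoclinic_points_subset:
  fixes \<alpha> :: "'g::group_add \<Rightarrow> 'x::topological_ab_group_add \<Rightarrow> 'x"
  assumes cpt: "compact (UNIV :: 'x set)" and act: "acts_by_automorphisms \<alpha>" and exp: "expansive \<alpha>"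
    and sep: "\<And>a::'x. a \<noteq> 0 \<Longrightarrow> \<exists>\<phi>\<in>pontryagin_dual. \<phi> a \<noteq> 1"
  shows "homoclinic_points \<alpha> \<subseteq> one_homoclinic_points \<alpha>"
  unfolding one_homoclinic_points_def
proof (intro subsetI CollectI ballI)
  fix x and \<phi> :: "'x \<Rightarrow> complex"
  assume "x \<in> homoclinic_points \<alpha>" and \<phi>: "\<phi> \<in> pontryagin_dual"
  then have x: "((\<lambda>s. \<alpha> s x) \<longlongrightarrow> 0) cofinite" by (simp add: homoclinic_points_def)
  obtain V where V: "open V" "0 \<in> V" "\<And>x. (\<And>s. \<alpha> s x \<in> V) \<Longrightarrow> x = 0"
    using expansive_neighbourhood[OF act exp] by blast
  obtain \<Phi>0 e0 where \<Phi>0: "finite \<Phi>0" "\<Phi>0 \<subseteq> pontryagin_dual" "e0 > 0"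
      "\<And>x. (\<And>\<phi>. \<phi> \<in> \<Phi>0 \<Longrightarrow> cmod (\<phi> x - 1) < e0) \<Longrightarrow> x \<in> V"
    using finite_Bohr_subset[OF cpt V(1,2) sep] by blast
  define \<Phi> where "\<Phi> = insert \<phi> \<Phi>0"
  have \<Phi>: "finite \<Phi>" "\<Phi> \<subseteq> pontryagin_dual" "\<phi> \<in> \<Phi>" "\<Phi>0 \<subseteq> \<Phi>"
    using \<Phi>0 \<phi> by (auto simp: \<Phi>_def)
  have dual: "\<zeta> \<in> pontryagin_dual" if "\<zeta> \<in> \<Phi>" for \<zeta> using that \<Phi>(2) by blast
  have "card \<Phi> > 0" using \<Phi>(1,3) by (auto simp: card_gt_0_iff)
  \<comment> \<open>Strictly below \<open>e0\<close>, so that non-strict bounds by \<open>e\<close>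
    still give membership in \<open>V\<close>, and below \<open>pi\<close>, as the linearization of
    angles demands.\<close>
  define e where "e = min (e0 / 2) 1"
  \<comment> \<open>Each of the \<open>card \<Phi>\<close> characters has coefficients of absolute
    sum at most \<open>d\<close>; together they sum to at most 1/2.\<close>
  define d where "d = 1 / (2 * real (card \<Phi>))"
  have e: "0 < e" "e < e0" "e < pi" using \<Phi>0(3) pi_gt3 by (auto simp: e_def)
  have d: "0 < d" "d \<le> 1" using \<open>card \<Phi> > 0\<close> by (auto simp: d_def)
  obtain \<eta> where \<eta>: "\<eta> > 0" "\<And>z. cmod (z - 1) < \<eta> \<Longrightarrow> \<bar>Arg z\<bar> < d * e / 4"
    using Arg_small[of "d * e / 4"] d e by auto
  define U where "U = (\<Inter>\<zeta>\<in>\<Phi>. {y. cmod (\<zeta> y - 1) < \<eta>})"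
  have opU: "open U"
    unfolding U_def using \<Phi>(1)
    by (intro open_INT ballI open_Collect_less continuous_intros) (use dual in \<open>auto simp: pontryagin_dual_def\<close>)
  have U0: "0 \<in> U"
    using \<eta>(1) by (auto simp: U_def pontryagin_dual_simps(3)[OF dual])
  have exp_e: "y = 0" if y: "\<And>s \<zeta>. \<zeta> \<in> \<Phi> \<Longrightarrow> cmod (\<zeta> (\<alpha> s y) - 1) \<le> e" for y
  proof (rule V(3), rule \<Phi>0(4))
    fix s \<zeta> assume "\<zeta> \<in> \<Phi>0"
    then show "cmod (\<zeta> (\<alpha> s y) - 1) < e0"
      using y[of \<zeta> s] \<Phi>(4) e(2) by (meson le_less_trans subsetD)
  qed
  obtain F0 where F0: "finite F0"
    "\<And>y. \<forall>s\<in>F0. \<forall>\<zeta>\<in>\<Phi>. cmod (\<zeta> (\<alpha> s y) - 1) \<le> e \<Longrightarrow> y \<in> U"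
    by (rule expansive_finite_window[OF cpt act opU U0 \<Phi>(2) exp_e]) blast+
  \<comment> \<open>The element 0 makes \<open>(\<zeta>, 0)\<close> an index in \<open>I\<close>:
    the coordinate of the character \<open>\<zeta>\<close> itself.\<close>
  define F where "F = insert 0 F0"
  define I where "I = \<Phi> \<times> F"
  define \<psi> where "\<psi> i y = fst i (\<alpha> (snd i) y)" for i :: "('x \<Rightarrow> complex) \<times> 'g" and y
  have I: "finite I" using \<Phi>(1) F0(1) by (simp add: I_def F_def)
  have unit: "cmod (\<psi> i y) = 1" and mult: "\<psi> i (y + z) = \<psi> i y * \<psi> i z" if "i \<in> I" for i y z
    using that pontryagin_dual_simps[OF dual[of "fst i"]] by (auto simp: I_def \<psi>_def acts_simps[OF act])
  have dom: "\<bar>Arg (\<psi> (\<zeta>, 0) y)\<bar> \<le> d * e / 4"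
    if c: "\<zeta> \<in> \<Phi>" and y: "\<And>i. i \<in> I \<Longrightarrow> \<bar>Arg (\<psi> i y)\<bar> \<le> e" for \<zeta> y
  proof -
    have "y \<in> U"
    proof (rule F0(2), intro ballI)
      fix s \<xi> assume "s \<in> F0" "\<xi> \<in> \<Phi>"
      then have i: "(\<xi>, s) \<in> I" by (simp add: I_def F_def)
      have "cmod (\<psi> (\<xi>, s) y - 1) \<le> e"
        using cmod_minus_one_le_Arg[OF unit[OF i]] y[OF i] by (rule order_trans)
      then show "cmod (\<xi> (\<alpha> s y) - 1) \<le> e" by (simp add: \<psi>_def)
    qed
    then show ?thesis
      using \<eta>(2) c by (auto simp: U_def \<psi>_def acts_simps[OF act] intro: less_imp_le)
  qed
  have sum_I: "sum g I = (\<Sum>s\<in>F. \<Sum>\<xi>\<in>\<Phi>. g (\<xi>, s))" for g :: "_ \<Rightarrow> real"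
    unfolding I_def by (subst sum.swap) (simp add: sum.cartesian_product)
  define \<rho> where "\<rho> = d * e / (4 * card I)"
  have "\<exists>c. (\<Sum>i\<in>I. \<bar>c i\<bar>) \<le> d \<and>
      (\<forall>y. (\<forall>i\<in>I. \<bar>Arg (\<psi> i y)\<bar> \<le> \<rho>) \<longrightarrow> Arg (\<psi> (\<zeta>, 0) y) = (\<Sum>i\<in>I. c i * Arg (\<psi> i y)))" if mem: "\<zeta> \<in> \<Phi>" for \<zeta>
  proof -
    have "(\<zeta>, 0) \<in> I" using mem by (simp add: I_def F_def)
    obtain c where "(\<Sum>i\<in>I. \<bar>c i\<bar>) \<le> d"
      "\<And>y. \<forall>i\<in>I. \<bar>Arg (\<psi> i y)\<bar> \<le> \<rho> \<Longrightarrow> Arg (\<psi> (\<zeta>, 0) y) = (\<Sum>i\<in>I. c i * Arg (\<psi> i y))"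
      unfolding \<rho>_def
      by (rule Arg_linearization[where \<psi> = \<psi>, OF I \<open>(\<zeta>, 0) \<in> I\<close> unit mult e(1,3) d dom[OF mem]]) blast+
    then show ?thesis by blast
  qed
  then have "\<forall>\<zeta>\<in>\<Phi>. \<exists>c. (\<Sum>i\<in>I. \<bar>c i\<bar>) \<le> d \<and>
      (\<forall>y. (\<forall>i\<in>I. \<bar>Arg (\<psi> i y)\<bar> \<le> \<rho>) \<longrightarrow> Arg (\<psi> (\<zeta>, 0) y) = (\<Sum>i\<in>I. c i * Arg (\<psi> i y)))" by blast
  from bchoice[OF this] obtain c where c: "\<And>\<zeta>. \<zeta> \<in> \<Phi> \<Longrightarrow> (\<Sum>i\<in>I. \<bar>c \<zeta> i\<bar>) \<le> d"
    "\<And>\<zeta> y. \<zeta> \<in> \<Phi> \<Longrightarrow> \<forall>i\<in>I. \<bar>Arg (\<psi> i y)\<bar> \<le> \<rho> \<Longrightarrow>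
       Arg (\<psi> (\<zeta>, 0) y) = (\<Sum>i\<in>I. c \<zeta> i * Arg (\<psi> i y))"
    by blast
  \<comment> \<open>All characters of \<open>\<Phi>\<close> enter at once, because the linear
    relation for one of them involves the angles of all the others.\<close>
  define u where "u t = (\<Sum>\<zeta>\<in>\<Phi>. \<bar>Arg (\<zeta> (\<alpha> t x))\<bar>)" for t
  define C where "C s = (\<Sum>\<zeta>\<in>\<Phi>. \<Sum>\<xi>\<in>\<Phi>. \<bar>c \<zeta> (\<xi>, s)\<bar>)" for s
  \<comment> \<open>The group elements at which the orbit is still too far from 0 for the linear
    relation. It is finite because \<open>x\<close> is homoclinic and \<open>I\<close> is
    finite.\<close>
  define E where "E = {t. \<not> (\<forall>i\<in>I. \<bar>Arg (\<psi> i (\<alpha> t x))\<bar> \<le> \<rho>)}"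
  have "I \<noteq> {}" using \<Phi>(3) by (auto simp: I_def F_def)
  then have "\<rho> > 0" using d e I by (simp add: \<rho>_def card_gt_0_iff)
  have "u summable_on UNIV"
  proof (rule summable_of_contraction)
    show "finite F" using F0(1) by (simp add: F_def)
    show "0 \<le> C s" for s unfolding C_def by (intro sum_nonneg) auto
    have "(\<Sum>s\<in>F. C s) = (\<Sum>\<zeta>\<in>\<Phi>. \<Sum>i\<in>I. \<bar>c \<zeta> i\<bar>)"
      unfolding C_def sum_I by (rule sum.swap)
    also have "\<dots> \<le> card \<Phi> * d" using c(1) by (intro sum_bounded_above)
    also have "\<dots> < 1" using \<open>card \<Phi> > 0\<close> by (simp add: d_def)
    finally show "(\<Sum>s\<in>F. C s) < 1" .
    show "0 \<le> u t" for t unfolding u_def by (intro sum_nonneg) auto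
    show "u t \<le> card \<Phi> * pi" for t
      unfolding u_def
    proof (intro sum_bounded_above)
      show "\<bar>Arg (\<zeta> (\<alpha> t x))\<bar> \<le> pi" for \<zeta>
        using Arg_bounded[of "\<zeta> (\<alpha> t x)"] by linarith
    qed
    have "\<forall>\<^sub>F t in cofinite. \<bar>Arg (\<psi> i (\<alpha> t x))\<bar> \<le> \<rho>" if i: "i \<in> I" for i
    proof -
      obtain r where r: "r > 0" "\<And>z. cmod (z - 1) < r \<Longrightarrow> \<bar>Arg z\<bar> < \<rho>"
        using Arg_small[OF \<open>\<rho> > 0\<close>] by blast
      have fd: "fst i \<in> pontryagin_dual" using i dual by (auto simp: I_def)
      have "((\<lambda>t. \<alpha> (snd i + t) x) \<longlongrightarrow> 0) cofinite"
        by (rule filterlim_compose[OF x filterlim_add_left_cofinite])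
      moreover have "(fst i \<longlongrightarrow> fst i 0) (nhds 0)"
        using fd by (simp add: pontryagin_dual_def continuous_on_def tendsto_at_iff_tendsto_nhds)
      ultimately have "((\<lambda>t. fst i (\<alpha> (snd i + t) x)) \<longlongrightarrow> fst i 0) cofinite"
        by (rule filterlim_compose[rotated])
      then have "((\<lambda>t. \<psi> i (\<alpha> t x)) \<longlongrightarrow> 1) cofinite"
        by (simp add: \<psi>_def acts_simps[OF act] pontryagin_dual_simps(3)[OF fd])
      from tendstoD[OF this r(1)] show ?thesis
        by eventually_elim (use r(2) in \<open>auto simp: dist_norm intro: less_imp_le\<close>)
    qed
    then have "\<forall>\<^sub>F t in cofinite. \<forall>i\<in>I. \<bar>Arg (\<psi> i (\<alpha> t x))\<bar> \<le> \<rho>"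
      using I by (simp add: eventually_ball_finite_distrib)
    then show "finite E" by (simp add: E_def eventually_cofinite)
    fix t assume "t \<notin> E"
    then have t: "\<forall>i\<in>I. \<bar>Arg (\<psi> i (\<alpha> t x))\<bar> \<le> \<rho>" by (simp add: E_def)
    have le: "\<bar>Arg (\<xi> (\<alpha> (s + t) x))\<bar> \<le> u (s + t)" if "\<xi> \<in> \<Phi>" for \<xi> s
      unfolding u_def using that \<Phi>(1) by (intro member_le_sum) auto
    have "u t = (\<Sum>\<zeta>\<in>\<Phi>. \<bar>\<Sum>i\<in>I. c \<zeta> i * Arg (\<psi> i (\<alpha> t x))\<bar>)"
      unfolding u_def using c(2)[OF _ t] by (intro sum.cong) (auto simp: \<psi>_def acts_simps[OF act])
    \<comment> \<open>The index \<open>(\<xi>, s)\<close> evaluated at \<open>\<alpha> t x\<close>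
      is the angle of \<open>\<xi>\<close> at \<open>\<alpha> (s + t) x\<close>: a left translate of
      the argument of \<open>u\<close>, as the contraction lemma requires.\<close>
    also have "\<dots> \<le> (\<Sum>\<zeta>\<in>\<Phi>. \<Sum>i\<in>I. \<bar>c \<zeta> i\<bar> * u (snd i + t))"
    proof (intro sum_mono order_trans[OF sum_abs])
      fix \<zeta> i assume "i \<in> I"
      then show "\<bar>c \<zeta> i * Arg (\<psi> i (\<alpha> t x))\<bar> \<le> \<bar>c \<zeta> i\<bar> * u (snd i + t)"
        unfolding abs_mult using le[of "fst i" "snd i"]
        by (intro mult_left_mono) (auto simp: I_def \<psi>_def acts_simps[OF act])
    qed
    also have "\<dots> = (\<Sum>s\<in>F. C s * u (s + t))"
      unfolding C_def sum_I sum_distrib_right snd_conv by (rule sum.swap)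
    finally show "u t \<le> (\<Sum>s\<in>F. C s * u (s + t))" .
  qed
  then show "(\<lambda>s. cmod (Psi \<alpha> x \<phi> s)) summable_on UNIV"
  proof (rule summable_on_comparison_test)
    fix s
    have "cmod (Psi \<alpha> x \<phi> s) \<le> \<bar>Arg (\<phi> (\<alpha> s x))\<bar>"
      unfolding Psi_def by (intro cmod_minus_one_le_Arg pontryagin_dual_simps(1)[OF \<phi>])
    also have "\<dots> \<le> u s"
      unfolding u_def using \<Phi>(1,3) by (intro member_le_sum) auto
    finally show "cmod (Psi \<alpha> x \<phi> s) \<le> u s" .
  qed simp
qed

theorem theorem5p6:
  fixes \<alpha> :: "'g::group_add \<Rightarrow> 'x::topological_ab_group_add \<Rightarrow> 'x"
  assumes "countable (UNIV :: 'g set)"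
    and "compact (UNIV :: 'x set)"
    and "metrizable_space (euclidean :: 'x topology)"
    and "acts_by_automorphisms \<alpha>"
    and "expansive \<alpha>"
  shows "homoclinic_points \<alpha> = one_homoclinic_points \<alpha>"
proof -
  obtain \<rho> :: "'x \<Rightarrow> 'x \<Rightarrow> real" where \<rho>: "compatible_metric \<rho>"
    using assms(5) unfolding expansive_def by blast
  have sep: "\<exists>\<phi>\<in>pontryagin_dual. \<phi> a \<noteq> 1" if "a \<noteq> 0" for a :: 'x
  proof -
    \<comment> \<open>The distance to 0 in a compatible metric is the continuous function from which
      the separating character is produced.\<close>
    have "continuous_on UNIV (\<lambda>x. complex_of_real (\<rho> x 0))"
      by (intro continuous_intros compatible_metric_continuous[OF \<rho>])
    moreover have "complex_of_real (\<rho> a 0) \<noteq> complex_of_real (\<rho> 0 0)"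
      using that compatible_metric_zero_iff[OF \<rho>] by (metis of_real_eq_iff)
    ultimately obtain \<phi> where "\<phi> \<in> pontryagin_dual" "\<phi> a \<noteq> 1"
      by (rule pontryagin_dual_separates[OF assms(2)])
    then show ?thesis by blast
  qed
  show ?thesis
    using homoclinic_points_subset[OF assms(2,4,5) sep] homoclinic_points_supset[OF assms(2) sep]
    by (rule equalityI)
qed

end
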